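(* For every $\tau\in\mathcal{H}$ the following equalities hold: \[\theta\big[{\textstyle{0 \atop 1/4}}\big]'(\tau,0)=-\pi\,\theta\big[{\textstyle{0 \atop 1/4}}\big](\tau,0)\Big(\sqrt{2}\,\theta\big[{\textstyle{0 \atop 0}}\big](2\tau,0)\,\theta\big[{\textstyle{1 \atop 0}}\big](4\tau,0)-\theta\big[{\textstyle{1 \atop 0}}\big]^{2}(4\tau,0)\Big),\] \[\theta\big[{\textstyle{0 \atop 3/4}}\big]'(\tau,0)=-\pi\,\theta\big[{\textstyle{0 \atop 3/4}}\big](\tau,0)\Big(\sqrt{2}\,\theta\big[{\textstyle{0 \atop 0}}\big](2\tau,0)\,\theta\big[{\textstyle{1 \atop 0}}\big](4\tau,0)+\theta\big[{\textstyle{1 \atop 0}}\big]^{2}(4\tau,0)\Big),\] \[\theta\big[{\textstyle{1/2 \atop 1/4}}\big]'(\tau,0)=\tfrac{\pi i}{2}\theta\big[{\textstyle{1/2 \atop 1/4}}\big](\tau,0)\Big[\theta\big[{\textstyle{0 \atop 0}}\big]^{2}(4\tau,0)-\theta\big[{\textstyle{1 \atop 0}}\big]^{2}(4\tau,0)-i\,\theta\big[{\textstyle{1 \atop 0}}\big]^{2}(2\tau,0)-\sqrt{2}\,\theta\big[{\textstyle{1 \atop 0}}\big](2\tau,0)\Big(\theta\big[{\textstyle{0 \atop 1}}\big](\tau,0)-i\,\theta\big[{\textstyle{0 \atop 0}}\big](\tau,0)\Big)\Big],\] \[\theta\big[{\textstyle{1/2 \atop 3/4}}\big]'(\tau,0)=\tfrac{\pi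 i}{2}\theta\big[{\textstyle{1/2 \atop 3/4}}\big](\tau,0)\Big[\theta\big[{\textstyle{0 \atop 0}}\big]^{2}(4\tau,0)-\theta\big[{\textstyle{1 \atop 0}}\big]^{2}(4\tau,0)+i\,\theta\big[{\textstyle{1 \atop 0}}\big]^{2}(2\tau,0)+\sqrt{2}\,\theta\big[{\textstyle{1 \atop 0}}\big](2\tau,0)\Big(\theta\big[{\textstyle{0 \atop 1}}\big](\tau,0)+i\,\theta\big[{\textstyle{0 \atop 0}}\big](\tau,0)\Big)\Big],\] \[\theta\big[{\textstyle{1/2 \atop 5/4}}\big]'(\tau,0)=\tfrac{\pi i}{2}\theta\big[{\textstyle{1/2 \atop 5/4}}\big](\tau,0)\Big[\theta\big[{\textstyle{0 \atop 0}}\big]^{2}(4\tau,0)-\theta\big[{\textstyle{1 \atop 0}}\big]^{2}(4\tau,0)-i\,\theta\big[{\textstyle{1 \atop 0}}\big]^{2}(2\tau,0)+\sqrt{2}\,\theta\big[{\textstyle{1 \atop 0}}\big](2\tau,0)\Big(\theta\big[{\textstyle{0 \atop 1}}\big](\tau,0)-i\,\theta\big[{\textstyle{0 \atop 0}}\big](\tau,0)\Big)\Big],\] \[\theta\big[{\textstyle{1/2 \atop 7/4}}\big]'(\tau,0)=\tfrac{\pi i}{2}\theta\big[{\textstyle{1/2 \atop 7/4}}\big](\tau,0)\Big[\theta\big[{\textstyle{0 \atop 0}}\big]^{2}(4\tau,0)-\theta\big[{\textstyle{1 \atop 0}}\big]^{2}(4\tau,0)+i\,\theta\big[{\textstyle{1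 \atop 0}}\big]^{2}(2\tau,0)-\sqrt{2}\,\theta\big[{\textstyle{1 \atop 0}}\big](2\tau,0)\Big(\theta\big[{\textstyle{0 \atop 1}}\big](\tau,0)+i\,\theta\big[{\textstyle{0 \atop 0}}\big](\tau,0)\Big)\Big].\]
   Context: $\mathcal{H}$ is the upper half-plane and $\mathbf{e}(u)=e^{2\pi iu}$. For real $\varepsilon,\delta$, $\tau\in\mathcal{H}$ and $z\in\mathbb{C}$, the theta function with characteristics is \[\theta\big[{\textstyle{\varepsilon \atop \delta}}\big](\tau,z)=\sum_{n=-\infty}^{\infty}\mathbf{e}\Big[\big(n+\tfrac{\varepsilon}{2}\big)^{2}\tfrac{\tau}{2}+\big(n+\tfrac{\varepsilon}{2}\big)\big(z+\tfrac{\delta}{2}\big)\Big].\] The prime denotes differentiation with respect to $z$ only, so $\theta\big[{\varepsilon \atop \delta}\big]'(\tau,0)$ is the $z$-derivative at $z=0$. The notation $\theta\big[{\varepsilon \atop \delta}\big]^{2}(\tau,0)$ means the square of the value $\theta\big[{\varepsilon \atop \delta}\big](\tau,0)$. *)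

theory Defs
  imports "HOL-Analysis.Analysis"
begin

definition e1 :: "complex \<Rightarrow> complex" where
  "e1 u = exp (2 * of_real pi * \<i> * u)"

text \<open>The series converges absolutely for \<open>Im \<tau> > 0\<close>, so the unordered sum
  over the integers is the classical two-sided sum; otherwise the value is irrelevant.\<close>

definition theta :: "real \<Rightarrow> real \<Rightarrow> complex \<Rightarrow> complex \<Rightarrow> complex" where
  "theta \<epsilon> \<delta> \<tau> z =
     (\<Sum>\<^sub>\<infinity>n::int. e1 ((of_int n + of_real \<epsilon> / 2)\<^sup>2 * (\<tau> / 2)
        + (of_int n + of_real \<epsilon> / 2) * (z + of_real \<delta> / 2)))"

definition theta_deriv :: "real \<Rightarrow> real \<Rightarrow> complex \<Rightarrow> complex \<Rightarrow> complex" where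
  "theta_deriv \<epsilon> \<delta> \<tau> z = deriv (theta \<epsilon> \<delta> \<tau>) z"

end

theory Submission
  imports Defs "HOL-Complex_Analysis.Complex_Analysis"
begin

text \<open>
  Translating \<open>z\<close> by \<open>1/2\<close> adds 1 to \<open>\<delta>\<close>. The product of a theta function and its translate is,
  up to a constant, a theta function of \<open>2 * \<tau>\<close>, which gives the sum of their logarithmic derivatives at \<open>0\<close>
  (\<open>theta_deriv_sum_half_period\<close>). The difference is \<open>2 \<pi> theta2 theta3\<close> at \<open>2 * \<tau>\<close> times a
  quotient of theta constants (\<open>theta_deriv_diff_half_period\<close>). Both facts
  are read off from one product formula (\<open>theta_mult\<close>), the latter with the help of Jacobi's formula
  \<open>\<theta>\<^sub>1' = - \<pi> \<theta>\<^sub>2 \<theta>\<^sub>3 \<theta>\<^sub>4\<close> in the sign convention of \<open>theta 1 1\<close>. Averaging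
  (\<open>log_deriv_descent\<close>) reduces a logarithmic derivative at \<open>\<delta>\<close> to the one at \<open>2 * \<delta> + 1\<close> and period
  \<open>2 * \<tau>\<close>, plus a quotient of theta constants. For \<open>\<delta> = 1/4\<close> one arrives at \<open>3/2\<close>, a
  quarter-period. There, if necessary after \<open>\<tau> \<mapsto> \<tau> + 1\<close>, the even and odd parts of the theta
  function are classical, so that Jacobi's formula applies directly.

  Two identities are not mere rearrangements of series: Jacobi's derivative formula
  (\<open>Jacobi_derivative_formula\<close>) and the value of \<open>theta 1 (3/2)\<close> at \<open>0\<close>
  (\<open>theta_1_3_2_const\<close>). Both follow from the same principle: the quotient of the two sides is invariant under
  \<open>\<tau> \<mapsto> 2 * \<tau>\<close> by product formulas, hence equals its limit as \<open>Im \<tau> \<rightarrow> \<infinity>\<close>, which is read off from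
  the leading terms (\<open>doubling_invariant_eq_limit\<close>, \<open>theta_limit_cusp\<close>).

  For \<open>\<epsilon> = 0\<close> and for \<open>\<epsilon> = 1/2\<close>, only \<open>\<delta> = 1/4\<close> requires this computation. The other
  characteristics arise from it by \<open>\<tau> \<mapsto> \<tau> + 1\<close>, which replaces \<open>\<delta>\<close> by \<open>\<delta> + 1 + \<epsilon>\<close>, and by
  the reflection \<open>z \<mapsto> - z\<close>.
\<close>

section \<open>The exponential factor\<close>

lemma e1_add: "e1 (u + v) = e1 u * e1 v"
  by (simp add: e1_def distrib_left exp_add)

lemma e1_nonzero [simp]: "e1 u \<noteq> 0"
  by (simp add: e1_def)

lemma e1_0 [simp]: "e1 0 = 1"
  by (simp add: e1_def)

lemma e1_of_int [simp]: "e1 (of_int n) = 1"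
  unfolding e1_def using exp_integer_2pi[of "of_int n"] by (simp add: mult_ac)

lemma e1_of_real: "e1 (of_real x) = cis (2 * pi * x)"
  by (simp add: e1_def cis_conv_exp mult_ac)

lemma norm_e1: "norm (e1 u) = exp (- 2 * pi * Im u)"
  by (simp add: e1_def)

lemma e1_half: "e1 (1/2) = -1"
  using e1_of_real [of "1/2"] by (simp add: cis_pi)

lemma e1_quarter: "e1 (1/4) = \<i>"
  using e1_of_real [of "1/4"] by (simp add: cis_pi_half)

lemma e1_3_quarters: "e1 (3/4) = - \<i>"
proof -
  have "3/4 = 1/2 + (1/4 :: complex)" by simp
  thus ?thesis by (simp only: e1_add e1_half e1_quarter) simp
qed

section \<open>Convergence and holomorphy\<close>

definition theta_term :: "real \<Rightarrow> real \<Rightarrow> complex \<Rightarrow> complex \<Rightarrow> int \<Rightarrow> complex" where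
  "theta_term \<epsilon> \<delta> \<tau> z n =
     e1 ((of_int n + of_real \<epsilon> / 2)\<^sup>2 * (\<tau> / 2) + (of_int n + of_real \<epsilon> / 2) * (z + of_real \<delta> / 2))"

lemma theta_altdef: "theta \<epsilon> \<delta> \<tau> z = infsum (theta_term \<epsilon> \<delta> \<tau> z) UNIV"
  by (simp add: theta_def theta_term_def [abs_def])

lemma norm_theta_term:
  "norm (theta_term \<epsilon> \<delta> \<tau> z n) =
     exp (- (pi * Im \<tau>) * (of_int n + \<epsilon> / 2)\<^sup>2 - 2 * pi * Im z * (of_int n + \<epsilon> / 2))"
proof -
  have a: "of_int n + of_real \<epsilon> / 2 = complex_of_real (of_int n + \<epsilon> / 2)"
    by simp
  show ?thesis
    unfolding theta_term_def a norm_e1 of_real_power [symmetric]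
    by (simp add: algebra_simps)
qed

lemma summable_exp_minus_abs_int: "(\<lambda>n::int. exp (- \<bar>real_of_int n\<bar>)) summable_on UNIV"
proof -
  have geo: "(\<lambda>n::nat. exp (- real n)) summable_on UNIV"
  proof -
    have "summable (\<lambda>n. exp (-1 :: real) ^ n)"
      by (rule summable_geometric) simp
    moreover have "exp (-1 :: real) ^ n = exp (- real n)" for n
      by (simp add: exp_of_nat_mult [symmetric])
    ultimately show ?thesis
      by (subst summable_on_UNIV_nonneg_real_iff) simp_all
  qed
  have "(\<lambda>n::int. exp (- \<bar>real_of_int n\<bar>)) summable_on range int"
    by (subst summable_on_reindex) (auto simp: o_def geo)
  moreover have "(\<lambda>n::int. exp (- \<bar>real_of_int n\<bar>)) summable_on range (\<lambda>n. - int n)"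
    by (subst summable_on_reindex) (auto simp: o_def geo inj_on_def)
  ultimately have "(\<lambda>n::int. exp (- \<bar>real_of_int n\<bar>)) summable_on range int \<union> range (\<lambda>n. - int n)"
    by (rule summable_on_union)
  moreover have "range int \<union> range (\<lambda>n. - int n) = UNIV"
  proof -
    have "n \<in> range int \<union> range (\<lambda>n. - int n)" for n
      by (cases n rule: int_cases2) auto
    thus ?thesis by blast
  qed
  ultimately show ?thesis by simp
qed

text \<open>Completing the square dominates the Gaussian by a multiple of \<open>exp (- \<bar>n\<bar>)\<close>.\<close>

lemma summable_gaussian_int:
  fixes \<alpha> \<beta> a :: real
  assumes "\<alpha> > 0"
  shows "(\<lambda>n::int. exp (- \<alpha> * (of_int n + a)\<^sup>2 + \<beta> * \<bar>of_int n + a\<bar>)) summable_on UNIV"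
proof (rule summable_on_comparison_test)
  let ?K = "(\<beta> + 1)\<^sup>2 / (4 * \<alpha>) + \<bar>a\<bar>"
  show "(\<lambda>n::int. exp ?K * exp (- \<bar>real_of_int n\<bar>)) summable_on UNIV"
    by (intro summable_on_cmult_right summable_exp_minus_abs_int)
  fix n :: int
  define t where "t = \<bar>of_int n + a\<bar>"
  have "0 \<le> (2 * \<alpha> * t - (\<beta> + 1))\<^sup>2 / (4 * \<alpha>)"
    using assms by simp
  also have "\<dots> = \<alpha> * t\<^sup>2 - (\<beta> + 1) * t + (\<beta> + 1)\<^sup>2 / (4 * \<alpha>)"
    using assms by (simp add: field_simps power2_eq_square)
  finally have "- \<alpha> * t\<^sup>2 + \<beta> * t \<le> (\<beta> + 1)\<^sup>2 / (4 * \<alpha>) - t"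
    by (simp add: algebra_simps)
  also have "\<dots> \<le> ?K - \<bar>real_of_int n\<bar>"
    unfolding t_def by linarith
  finally show "exp (- \<alpha> * (of_int n + a)\<^sup>2 + \<beta> * \<bar>of_int n + a\<bar>) \<le> exp ?K * exp (- \<bar>real_of_int n\<bar>)"
    unfolding t_def by (simp add: exp_add [symmetric] exp_diff [symmetric])
qed auto

text \<open>A bound for the terms of the series on the strip \<open>\<bar>Im z\<bar> \<le> R\<close> that is
  independent of \<open>\<delta>\<close> and of the real parts, as the Weierstrass M-test requires.\<close>

definition theta_majorant :: "real \<Rightarrow> real \<Rightarrow> real \<Rightarrow> int \<Rightarrow> real" where
  "theta_majorant \<epsilon> y R n = exp (- (pi * y) * (of_int n + \<epsilon> / 2)\<^sup>2 + 2 * pi * R * \<bar>of_int n + \<epsilon> / 2\<bar>)"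

lemma summable_theta_majorant: "y > 0 \<Longrightarrow> theta_majorant \<epsilon> y R summable_on UNIV"
  unfolding theta_majorant_def by (rule summable_gaussian_int) simp

lemma norm_theta_term_le:
  assumes "\<bar>Im z\<bar> \<le> R"
  shows "norm (theta_term \<epsilon> \<delta> \<tau> z n) \<le> theta_majorant \<epsilon> (Im \<tau>) R n"
proof -
  have "- (Im z * (of_int n + \<epsilon> / 2)) \<le> \<bar>Im z\<bar> * \<bar>of_int n + \<epsilon> / 2\<bar>"
    by (metis abs_ge_minus_self abs_mult)
  also have "\<dots> \<le> R * \<bar>of_int n + \<epsilon> / 2\<bar>"
    using assms by (intro mult_right_mono) auto
  finally have "2 * pi * - (Im z * (of_int n + \<epsilon> / 2)) \<le> 2 * pi * (R * \<bar>of_int n + \<epsilon> / 2\<bar>)"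
    by (intro mult_left_mono) auto
  thus ?thesis
    unfolding norm_theta_term theta_majorant_def by (simp add: algebra_simps)
qed

lemma theta_term_abs_summable:
  assumes "Im \<tau> > 0"
  shows "(\<lambda>n. norm (theta_term \<epsilon> \<delta> \<tau> z n)) summable_on UNIV"
  by (rule summable_on_comparison_test [OF summable_theta_majorant [OF assms, of \<epsilon> "\<bar>Im z\<bar>"]])
     (auto intro: norm_theta_term_le)

lemma theta_term_summable:
  assumes "Im \<tau> > 0"
  shows "theta_term \<epsilon> \<delta> \<tau> z summable_on UNIV"
  using theta_term_abs_summable [OF assms] by (rule abs_summable_summable)

lemma theta_holomorphic:
  assumes "Im \<tau> > 0"
  shows "theta \<epsilon> \<delta> \<tau> holomorphic_on UNIV"
proof -
  have "theta \<epsilon> \<delta> \<tau> field_differentiable at z" for z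
  proof -
    have "uniform_limit (cball z 1) (\<lambda>X w. \<Sum>n\<in>X. theta_term \<epsilon> \<delta> \<tau> w n)
            (\<lambda>w. \<Sum>\<^sub>\<infinity>n\<in>UNIV. theta_term \<epsilon> \<delta> \<tau> w n) (finite_subsets_at_top UNIV)"
    proof (rule Weierstrass_m_test_general)
      fix n :: int and w assume "w \<in> cball z 1"
      hence "\<bar>Im w\<bar> \<le> \<bar>Im z\<bar> + 1"
        using abs_Im_le_cmod [of "z - w"] by (auto simp: dist_norm)
      thus "norm (theta_term \<epsilon> \<delta> \<tau> w n) \<le> theta_majorant \<epsilon> (Im \<tau>) (\<bar>Im z\<bar> + 1) n"
        by (rule norm_theta_term_le)
    qed (rule summable_theta_majorant [OF assms])
    hence *: "uniform_limit (cball z 1) (\<lambda>X w. \<Sum>n\<in>X. theta_term \<epsilon> \<delta> \<tau> w n)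
            (theta \<epsilon> \<delta> \<tau>) (finite_subsets_at_top UNIV)"
      by (simp add: theta_altdef [abs_def])
    have "theta \<epsilon> \<delta> \<tau> holomorphic_on ball z 1"
    proof (rule holomorphic_uniform_limit [OF _ *])
      have "(\<lambda>w. theta_term \<epsilon> \<delta> \<tau> w n) holomorphic_on A" for n A
        unfolding theta_term_def e1_def by (intro holomorphic_intros)
      hence "(\<lambda>w. \<Sum>n\<in>X. theta_term \<epsilon> \<delta> \<tau> w n) holomorphic_on A" for X A
        by (intro holomorphic_intros)
      thus "\<forall>\<^sub>F X in finite_subsets_at_top UNIV.
              continuous_on (cball z 1) (\<lambda>w. \<Sum>n\<in>X. theta_term \<epsilon> \<delta> \<tau> w n) \<and>
              (\<lambda>w. \<Sum>n\<in>X. theta_term \<epsilon> \<delta> \<tau> w n) holomorphic_on ball z 1"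
        by (intro always_eventually allI conjI holomorphic_on_imp_continuous_on)
    qed auto
    thus ?thesis
      by (rule holomorphic_on_imp_differentiable_at) auto
  qed
  thus ?thesis
    by (simp add: holomorphic_on_def field_differentiable_at_within)
qed

lemma has_field_derivative_theta:
  assumes "Im \<tau> > 0"
  shows "(theta \<epsilon> \<delta> \<tau> has_field_derivative theta_deriv \<epsilon> \<delta> \<tau> z) (at z)"
  unfolding theta_deriv_def
  by (rule holomorphic_derivI [OF theta_holomorphic [OF assms]]) auto

section \<open>Symmetries\<close>

lemma infsum_bij_cong:
  assumes "bij_betw g A B" and "\<And>n. n \<in> A \<Longrightarrow> f n = h (g n)"
  shows "infsum f A = infsum h B"
  using assms(2) infsum_reindex_bij_betw [OF assms(1), of h] by (simp cong: infsum_cong)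

lemma theta_eps_add_2: "theta (\<epsilon> + 2) \<delta> \<tau> z = theta \<epsilon> \<delta> \<tau> z"
proof -
  have "theta_term (\<epsilon> + 2) \<delta> \<tau> z n = theta_term \<epsilon> \<delta> \<tau> z (n + 1)" for n
    by (simp add: theta_term_def add_divide_distrib algebra_simps)
  moreover have "bij_betw (\<lambda>n::int. n + 1) UNIV UNIV"
    by (rule bij_betwI [where g = "\<lambda>n. n - 1"]) auto
  ultimately show ?thesis
    unfolding theta_altdef by (intro infsum_bij_cong) auto
qed

lemma theta_delta_add_2: "theta \<epsilon> (\<delta> + 2) \<tau> z = e1 (of_real \<epsilon> / 2) * theta \<epsilon> \<delta> \<tau> z"
proof -
  have "theta_term \<epsilon> (\<delta> + 2) \<tau> z n = e1 (of_real \<epsilon> / 2) * theta_term \<epsilon> \<delta> \<tau> z n" for n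
  proof -
    have "(of_int n + of_real \<epsilon> / 2)\<^sup>2 * (\<tau> / 2) + (of_int n + of_real \<epsilon> / 2) * (z + of_real (\<delta> + 2) / 2)
        = of_int n + (of_real \<epsilon> / 2 + ((of_int n + of_real \<epsilon> / 2)\<^sup>2 * (\<tau> / 2)
            + (of_int n + of_real \<epsilon> / 2) * (z + of_real \<delta> / 2)))"
      by (simp add: add_divide_distrib algebra_simps)
    thus ?thesis
      unfolding theta_term_def by (simp only: e1_add e1_of_int mult_1_left)
  qed
  thus ?thesis
    unfolding theta_altdef by (simp add: infsum_cmult_right' cong: infsum_cong)
qed

lemma theta_minus: "theta (-\<epsilon>) (-\<delta>) \<tau> (-z) = theta \<epsilon> \<delta> \<tau> z"
proof -
  have "theta_term (-\<epsilon>) (-\<delta>) \<tau> (-z) n = theta_term \<epsilon> \<delta> \<tau> z (- n)" for n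
  proof -
    have "(of_int n + of_real (-\<epsilon>) / 2)\<^sup>2 = (of_int (-n) + of_real \<epsilon> / (2::complex))\<^sup>2"
      by (simp add: power2_eq_square algebra_simps)
    moreover have "(of_int n + of_real (-\<epsilon>) / 2) * (- z + of_real (-\<delta>) / 2)
        = (of_int (-n) + of_real \<epsilon> / 2) * (z + of_real \<delta> / 2)"
      by (simp add: algebra_simps)
    ultimately show ?thesis
      unfolding theta_term_def by (simp only:)
  qed
  moreover have "bij_betw (uminus :: int \<Rightarrow> int) UNIV UNIV"
    by (rule bij_betwI [where g = uminus]) auto
  ultimately show ?thesis
    unfolding theta_altdef by (intro infsum_bij_cong) auto
qed

text \<open>The shift changes the exponent of the \<open>n\<close>-th term by \<open>(n + \<epsilon>/2)\<^sup>2 / 2\<close>. Since \<open>n\<^sup>2 \<equiv> n\<close> modulo 2,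
  this is linear in \<open>n\<close> up to an integer, hence absorbed by \<open>\<delta>\<close>.\<close>

lemma theta_tau_add_1:
  "theta \<epsilon> \<delta> (\<tau> + 1) z =
     e1 (of_real (\<epsilon>\<^sup>2 / 8 - \<epsilon> * (1 + \<epsilon>) / 4)) * theta \<epsilon> (\<delta> + 1 + \<epsilon>) \<tau> z"
proof -
  have "theta_term \<epsilon> \<delta> (\<tau> + 1) z n
      = e1 (of_real (\<epsilon>\<^sup>2 / 8 - \<epsilon> * (1 + \<epsilon>) / 4)) * theta_term \<epsilon> (\<delta> + 1 + \<epsilon>) \<tau> z n" for n
  proof -
    have "even (n * (n - 1))" by simp
    then obtain k where "n * (n - 1) = 2 * k" by (elim evenE)
    hence "(of_int n :: complex) * (of_int n - 1) = 2 * of_int k"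
      by (metis of_int_1 of_int_diff of_int_mult of_int_numeral)
    hence k: "of_int k = (of_int n * (of_int n - 1) / 2 :: complex)"
      by simp
    have "(x + e / 2)\<^sup>2 * ((\<tau> + 1) / 2) + (x + e / 2) * (z + d / 2)
        = x * (x - 1) / 2 + ((e\<^sup>2 / 8 - e * (1 + e) / 4) + ((x + e / 2)\<^sup>2 * (\<tau> / 2)
            + (x + e / 2) * (z + (d + 1 + e) / 2)))" for x e d :: complex
      by (simp add: power2_eq_square field_simps)
    from this [of "of_int n" "of_real \<epsilon>" "of_real \<delta>"]
    have "(of_int n + of_real \<epsilon> / 2)\<^sup>2 * ((\<tau> + 1) / 2) + (of_int n + of_real \<epsilon> / 2) * (z + of_real \<delta> / 2)
        = of_int k + (of_real (\<epsilon>\<^sup>2 / 8 - \<epsilon> * (1 + \<epsilon>) / 4) + ((of_int n + of_real \<epsilon> / 2)\<^sup>2 * (\<tau> / 2)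
            + (of_int n + of_real \<epsilon> / 2) * (z + of_real (\<delta> + 1 + \<epsilon>) / 2)))"
      by (simp only: k of_real_add of_real_diff of_real_mult of_real_divide of_real_power of_real_1 of_real_numeral)
    thus ?thesis
      unfolding theta_term_def by (simp only: e1_add e1_of_int mult_1_left)
  qed
  thus ?thesis
    unfolding theta_altdef by (simp add: infsum_cmult_right' cong: infsum_cong)
qed

section \<open>Dissection and products\<close>

text \<open>The two summands are the contributions of the even and of the odd \<open>n\<close>.\<close>

lemma theta_dissect:
  assumes "Im \<tau> > 0"
  shows "theta \<epsilon> \<delta> \<tau> z = theta (\<epsilon>/2) (2*\<delta>) (4*\<tau>) (2*z) + theta (\<epsilon>/2 + 1) (2*\<delta>) (4*\<tau>) (2*z)"
proof -
  let ?f = "theta_term \<epsilon> \<delta> \<tau> z"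
  have even: "theta_term (\<epsilon>/2) (2*\<delta>) (4*\<tau>) (2*z) n = ?f (2 * n)" for n
    by (simp add: theta_term_def power2_eq_square algebra_simps)
  have odd: "theta_term (\<epsilon>/2 + 1) (2*\<delta>) (4*\<tau>) (2*z) n = ?f (2 * n + 1)" for n
    by (simp add: theta_term_def power2_eq_square add_divide_distrib algebra_simps)
  have "bij_betw (\<lambda>n::int. 2 * n) UNIV {n. even n}"
    by (rule bij_betwI [where g = "\<lambda>n. n div 2"]) auto
  hence E: "theta (\<epsilon>/2) (2*\<delta>) (4*\<tau>) (2*z) = infsum ?f {n. even n}"
    unfolding theta_altdef by (rule infsum_bij_cong) (rule even)
  have "bij_betw (\<lambda>n::int. 2 * n + 1) UNIV {n. odd n}"
    by (rule bij_betwI [where g = "\<lambda>n. n div 2"]) auto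
  hence O: "theta (\<epsilon>/2 + 1) (2*\<delta>) (4*\<tau>) (2*z) = infsum ?f {n. odd n}"
    unfolding theta_altdef by (rule infsum_bij_cong) (rule odd)
  have "infsum ?f ({n. even n} \<union> {n. odd n}) = infsum ?f {n. even n} + infsum ?f {n. odd n}"
    by (rule infsum_Un_disjoint)
       (use theta_term_summable [OF assms] summable_on_subset_banach in blast)+
  moreover have "{n::int. even n} \<union> {n. odd n} = UNIV" by auto
  ultimately show ?thesis
    by (simp add: E O theta_altdef [of \<epsilon> \<delta> \<tau> z])
qed

text \<open>With \<open>u = m + \<epsilon>/2\<close> and \<open>v = n + \<epsilon>'/2\<close> for \<open>m = k + l + b\<close>, \<open>n = k - l\<close>, this is
  \<open>u\<^sup>2 + v\<^sup>2 = ((u + v)\<^sup>2 + (u - v)\<^sup>2) / 2\<close>, where \<open>u + v\<close> and \<open>u - v\<close> are twice the numbers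
  \<open>k + \<dots>\<close> and \<open>l + \<dots>\<close> occurring on the right; doubling \<open>\<tau>\<close> compensates the factor.\<close>

lemma theta_term_mult:
  fixes k l b :: int
  shows "theta_term \<epsilon> \<delta> \<tau> x (k + l + b) * theta_term \<epsilon>' \<delta>' \<tau> y (k - l)
     = theta_term ((\<epsilon> + \<epsilon>')/2 + b) (\<delta> + \<delta>') (2*\<tau>) (x + y) k
       * theta_term ((\<epsilon> - \<epsilon>')/2 + b) (\<delta> - \<delta>') (2*\<tau>) (x - y) l"
  unfolding theta_term_def e1_add [symmetric]
  by (rule arg_cong [of _ _ e1]) (simp add: power2_eq_square field_simps)

lemma half_sum_diff_int:
  fixes m n :: int
  shows "even (m + n) \<Longrightarrow> (m + n) div 2 + (m - n) div 2 = m"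
    and "even (m + n) \<Longrightarrow> (m + n) div 2 - (m - n) div 2 = n"
    and "odd (m + n) \<Longrightarrow> (m + n) div 2 + (m - n) div 2 + 1 = m"
    and "odd (m + n) \<Longrightarrow> (m + n) div 2 - (m - n) div 2 = n"
  by presburger+

text \<open>Pairs of integers with even, respectively odd, sum are parametrised by half sums and
  half differences; the two classes become the two summands in the product formula below.\<close>

lemma infsum_int_pairs_parity:
  fixes F :: "int \<times> int \<Rightarrow> complex"
  assumes "F summable_on UNIV"
  shows "infsum F UNIV = infsum (\<lambda>(k,l). F (k + l, k - l)) UNIV + infsum (\<lambda>(k,l). F (k + l + 1, k - l)) UNIV"
proof -
  let ?E = "{(m,n::int). even (m + n)}" and ?O = "{(m,n::int). odd (m + n)}"
  have 0: "infsum (\<lambda>(k,l). F (k + l, k - l)) UNIV = infsum F ?E"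
  proof (rule infsum_bij_cong)
    show "bij_betw (\<lambda>(k,l). (k + l, k - l)) UNIV ?E"
      by (rule bij_betwI [where g = "\<lambda>(m,n). ((m + n) div 2, (m - n) div 2)"])
         (auto simp: half_sum_diff_int simp del: even_add odd_add)
  qed auto
  have 1: "infsum (\<lambda>(k,l). F (k + l + 1, k - l)) UNIV = infsum F ?O"
  proof (rule infsum_bij_cong)
    show "bij_betw (\<lambda>(k,l). (k + l + 1, k - l)) UNIV ?O"
      by (rule bij_betwI [where g = "\<lambda>(m,n). ((m + n) div 2, (m - n) div 2)"])
         (auto simp: half_sum_diff_int simp del: even_add odd_add)
  qed auto
  have "infsum F (?E \<union> ?O) = infsum F ?E + infsum F ?O"
    by (rule infsum_Un_disjoint) (use assms summable_on_subset_banach in blast)+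
  moreover have "?E \<union> ?O = UNIV" by auto
  ultimately show ?thesis
    by (simp add: 0 1)
qed

lemma infsum_mult_pairs:
  fixes f g :: "int \<Rightarrow> complex"
  assumes "(\<lambda>n. norm (f n)) summable_on UNIV" "(\<lambda>n. norm (g n)) summable_on UNIV"
  shows "(\<lambda>(m,n). f m * g n) summable_on UNIV"
    and "infsum (\<lambda>(m,n). f m * g n) UNIV = infsum f UNIV * infsum g UNIV"
proof -
  have "(\<lambda>p. norm ((\<lambda>(m,n). f m * g n) p)) summable_on UNIV \<times> UNIV"
    by (subst Infinite_Sum.abs_summable_on_Sigma_iff)
       (auto simp: norm_mult infsum_cmult_right' abs_mult infsum_nonneg intro!: summable_on_cmult_right summable_on_cmult_left assms)
  thus S: "(\<lambda>(m,n). f m * g n) summable_on UNIV"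
    using abs_summable_summable by fastforce
  show "infsum (\<lambda>(m,n). f m * g n) UNIV = infsum f UNIV * infsum g UNIV"
    using infsum_Sigma'_banach [of "\<lambda>m n. f m * g n" UNIV "\<lambda>_. UNIV"] S
    by (simp add: infsum_cmult_right' infsum_cmult_left')
qed

text \<open>The product formula behind all algebraic identities of this theory. It holds for
  arbitrary real characteristics because it is only a rearrangement of the double series.\<close>

lemma theta_mult:
  assumes "Im \<tau> > 0"
  shows "theta \<epsilon> \<delta> \<tau> x * theta \<epsilon>' \<delta>' \<tau> y =
      theta ((\<epsilon> + \<epsilon>')/2) (\<delta> + \<delta>') (2*\<tau>) (x + y) * theta ((\<epsilon> - \<epsilon>')/2) (\<delta> - \<delta>') (2*\<tau>) (x - y)
    + theta ((\<epsilon> + \<epsilon>')/2 + 1) (\<delta> + \<delta>') (2*\<tau>) (x + y) * theta ((\<epsilon> - \<epsilon>')/2 + 1) (\<delta> - \<delta>') (2*\<tau>) (x - y)"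
proof -
  have t2: "Im (2 * \<tau>) > 0" using assms by simp
  note S = theta_term_abs_summable [OF assms] and S2 = theta_term_abs_summable [OF t2]
  have "theta \<epsilon> \<delta> \<tau> x * theta \<epsilon>' \<delta>' \<tau> y = infsum (\<lambda>(m,n). theta_term \<epsilon> \<delta> \<tau> x m * theta_term \<epsilon>' \<delta>' \<tau> y n) UNIV"
    by (simp add: theta_altdef infsum_mult_pairs(2) [OF S S])
  also have "\<dots> = infsum (\<lambda>(k,l). theta_term \<epsilon> \<delta> \<tau> x (k + l) * theta_term \<epsilon>' \<delta>' \<tau> y (k - l)) UNIV
      + infsum (\<lambda>(k,l). theta_term \<epsilon> \<delta> \<tau> x (k + l + 1) * theta_term \<epsilon>' \<delta>' \<tau> y (k - l)) UNIV"
    by (subst infsum_int_pairs_parity [OF infsum_mult_pairs(1) [OF S S]]) simp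
  also have "\<dots> = theta ((\<epsilon> + \<epsilon>')/2) (\<delta> + \<delta>') (2*\<tau>) (x + y) * theta ((\<epsilon> - \<epsilon>')/2) (\<delta> - \<delta>') (2*\<tau>) (x - y)
    + theta ((\<epsilon> + \<epsilon>')/2 + 1) (\<delta> + \<delta>') (2*\<tau>) (x + y) * theta ((\<epsilon> - \<epsilon>')/2 + 1) (\<delta> - \<delta>') (2*\<tau>) (x - y)"
    using theta_term_mult [of \<epsilon> \<delta> \<tau> x _ _ 0 \<epsilon>' \<delta>' y] theta_term_mult [of \<epsilon> \<delta> \<tau> x _ _ 1 \<epsilon>' \<delta>' y]
    by (simp add: theta_altdef infsum_mult_pairs(2) [OF S2 S2, symmetric])
  finally show ?thesis .
qed

section \<open>The cusp\<close>

text \<open>After division by the leading power \<open>e1 (\<epsilon>\<^sup>2 \<tau> / 8)\<close>, the exponent of \<open>e1 \<tau>\<close> in the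
  \<open>n\<close>-th term is \<open>n (n + \<epsilon>) / 2\<close>. It vanishes for \<open>n = 0\<close> and \<open>n = - \<epsilon>\<close> only, and all other
  terms together are \<open>O(exp (- \<pi> Im \<tau>))\<close>. Uniformity in \<open>z\<close> makes the limit compatible with \<open>z\<close>-derivatives.\<close>

lemma theta_limit_cusp:
  fixes \<epsilon> :: int and \<delta> :: real
  assumes "\<epsilon> = 0 \<or> \<epsilon> = 1"
  shows "uniform_limit (cball 0 1) (\<lambda>\<tau> z. e1 (- (of_int \<epsilon>)\<^sup>2 * \<tau> / 8) * theta (of_int \<epsilon>) \<delta> \<tau> z)
           (\<lambda>z. \<Sum>n\<in>{0,-\<epsilon>}. e1 ((of_int n + of_int \<epsilon> / 2) * (z + of_real \<delta> / 2)))
           (filtercomap Im at_top)"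
proof -
  let ?S = "{0, - \<epsilon>}"
  let ?f = "\<lambda>\<tau> z n. e1 (- (of_int \<epsilon>)\<^sup>2 * \<tau> / 8) * theta_term (of_int \<epsilon>) \<delta> \<tau> z n"
  define M where "M = (\<lambda>n. exp (pi * (of_int \<epsilon>)\<^sup>2 / 4) * theta_majorant (of_int \<epsilon>) 1 1 n)"
  have M: "M summable_on A" for A
    unfolding M_def
    by (intro summable_on_cmult_right summable_on_subset_banach [OF summable_theta_majorant]) auto
  define K where "K = infsum M (- ?S)"
  have bound: "dist (e1 (- (of_int \<epsilon>)\<^sup>2 * \<tau> / 8) * theta (of_int \<epsilon>) \<delta> \<tau> z)
        (\<Sum>n\<in>?S. e1 ((of_int n + of_int \<epsilon> / 2) * (z + of_real \<delta> / 2)))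
          \<le> exp (- pi * (Im \<tau> - 1)) * K" if \<tau>: "Im \<tau> \<ge> 1" and z: "z \<in> cball 0 1" for \<tau> z
  proof -
    have \<tau>0: "Im \<tau> > 0" using \<tau> by simp
    have z1: "\<bar>Im z\<bar> \<le> 1" using z abs_Im_le_cmod [of z] by auto
    have summ: "?f \<tau> z summable_on A" for A
      by (intro summable_on_cmult_right summable_on_subset_banach [OF theta_term_summable [OF \<tau>0]]) auto
    have main: "?f \<tau> z n = e1 ((of_int n + of_int \<epsilon> / 2) * (z + of_real \<delta> / 2))" if "n \<in> ?S" for n
    proof -
      have "(of_int n + of_int \<epsilon> / 2 :: complex)\<^sup>2 = (of_int \<epsilon>)\<^sup>2 / 4"
        using that by (auto simp: power2_eq_square field_simps)
      hence "- (of_int \<epsilon>)\<^sup>2 * \<tau> / 8 + ((of_int n + of_int \<epsilon> / 2)\<^sup>2 * (\<tau> / 2) + w) = w" for w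
        by (simp only:) simp
      thus ?thesis
        unfolding theta_term_def e1_add [symmetric] of_real_of_int_eq by (simp only:)
    qed
    have tail: "norm (?f \<tau> z n) \<le> exp (- pi * (Im \<tau> - 1)) * M n" if "n \<in> - ?S" for n
    proof -
      let ?g = "real_of_int (n * (n + \<epsilon>))"
      have "n * (n + \<epsilon>) \<ge> 1"
      proof (cases "n > 0")
        case True
        thus ?thesis using assms mult_mono [of 1 n 1 "n + \<epsilon>"] by auto
      next
        case False
        hence "- n \<ge> 1" "- (n + \<epsilon>) \<ge> 1" using that assms by auto
        hence "1 * 1 \<le> (- n) * (- (n + \<epsilon>))" by (intro mult_mono) auto
        thus ?thesis by (simp only: minus_mult_minus mult_1_left)
      qed
      hence "?g \<ge> 1" by linarith
      \<comment> \<open>This yields \<open>Im \<tau> * ?g \<ge> (Im \<tau> - 1) + ?g\<close>: decay in \<open>\<tau>\<close> splits off from summability in \<open>n\<close>.\<close>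
      hence "(Im \<tau> - 1) * (?g - 1) \<ge> 0" using \<tau> by simp
      hence g: "pi * ((Im \<tau> - 1) * (?g - 1)) \<ge> 0" by simp
      have norm_e: "norm (e1 (- (of_int \<epsilon>)\<^sup>2 * \<tau> / 8)) = exp (pi * Im \<tau> * (of_int \<epsilon>)\<^sup>2 / 4)"
        using assms by (auto simp: norm_e1)
      have "norm (?f \<tau> z n) \<le> exp (pi * Im \<tau> * (of_int \<epsilon>)\<^sup>2 / 4) * theta_majorant (of_int \<epsilon>) (Im \<tau>) 1 n"
        unfolding norm_mult norm_e by (intro mult_left_mono norm_theta_term_le z1) auto
      also have "\<dots> \<le> exp (- pi * (Im \<tau> - 1)) * M n"
        unfolding M_def theta_majorant_def exp_add [symmetric] exp_le_cancel_iff
        using g by (simp add: power2_eq_square algebra_simps)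
      finally show ?thesis .
    qed
    have "e1 (- (of_int \<epsilon>)\<^sup>2 * \<tau> / 8) * theta (of_int \<epsilon>) \<delta> \<tau> z = infsum (?f \<tau> z) (?S \<union> - ?S)"
      unfolding theta_altdef by (simp add: infsum_cmult_right')
    also have "\<dots> = infsum (?f \<tau> z) ?S + infsum (?f \<tau> z) (- ?S)"
      by (rule infsum_Un_disjoint) (use summ in auto)
    also have "infsum (?f \<tau> z) ?S = (\<Sum>n\<in>?S. e1 ((of_int n + of_int \<epsilon> / 2) * (z + of_real \<delta> / 2)))"
      by (subst infsum_finite) (simp, intro sum.cong refl main)
    finally have "dist (e1 (- (of_int \<epsilon>)\<^sup>2 * \<tau> / 8) * theta (of_int \<epsilon>) \<delta> \<tau> z)
        (\<Sum>n\<in>?S. e1 ((of_int n + of_int \<epsilon> / 2) * (z + of_real \<delta> / 2))) = norm (infsum (?f \<tau> z) (- ?S))"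
      by (simp add: dist_norm)
    also have "\<dots> \<le> infsum (\<lambda>n. exp (- pi * (Im \<tau> - 1)) * M n) (- ?S)"
      by (rule norm_infsum_le [OF has_sum_infsum [OF summ] has_sum_infsum [OF summable_on_cmult_right [OF M]] tail])
    also have "\<dots> = exp (- pi * (Im \<tau> - 1)) * K"
      unfolding K_def by (rule infsum_cmult_right')
    finally show ?thesis .
  qed
  have lim: "((\<lambda>\<tau>. exp (- pi * (Im \<tau> - 1)) * K) \<longlongrightarrow> 0) (filtercomap Im at_top)"
  proof -
    have "((\<lambda>y. exp (- pi * (y - 1)) * K) \<longlongrightarrow> 0) at_top"
      by real_asymp
    thus ?thesis
      by (rule filterlim_compose) (rule filterlim_filtercomap)
  qed
  show ?thesis
  proof (rule uniform_limitI)
    fix e :: real assume "e > 0"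
    from lim have "\<forall>\<^sub>F \<tau> in filtercomap Im at_top. exp (- pi * (Im \<tau> - 1)) * K < e"
      using \<open>e > 0\<close> by (rule order_tendstoD)
    moreover have "\<forall>\<^sub>F \<tau> in filtercomap Im at_top. Im \<tau> \<ge> 1"
      by (rule eventually_filtercomapI [OF eventually_ge_at_top])
    ultimately show "\<forall>\<^sub>F \<tau> in filtercomap Im at_top. \<forall>z\<in>cball 0 1.
        dist (e1 (- (of_int \<epsilon>)\<^sup>2 * \<tau> / 8) * theta (of_int \<epsilon>) \<delta> \<tau> z)
        (\<Sum>n\<in>?S. e1 ((of_int n + of_int \<epsilon> / 2) * (z + of_real \<delta> / 2))) < e"
      by eventually_elim (use bound in force)
  qed
qed

lemma theta_0_tendsto_cusp: "((\<lambda>\<tau>. theta 0 \<delta> \<tau> 0) \<longlongrightarrow> 1) (filtercomap Im at_top)"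
  using tendsto_uniform_limitI [OF theta_limit_cusp [of 0 \<delta>], of 0] by simp

lemma theta_1_tendsto_cusp:
  "((\<lambda>\<tau>. e1 (- \<tau> / 8) * theta 1 \<delta> \<tau> 0) \<longlongrightarrow> of_real (2 * cos (pi * \<delta> / 2))) (filtercomap Im at_top)"
proof -
  have "e1 (of_real \<delta> / 4) + e1 (- of_real \<delta> / 4) = of_real (2 * cos (pi * \<delta> / 2))"
    using e1_of_real [of "\<delta> / 4"] e1_of_real [of "- \<delta> / 4"]
    by (simp add: complex_eq_iff algebra_simps)
  thus ?thesis
    using tendsto_uniform_limitI [OF theta_limit_cusp [of 1 \<delta>], of 0] by (simp add: field_simps)
qed

lemma nontrivial_cusp: "filtercomap Im at_top \<noteq> bot"
proof -
  have "surj Im" by (metis complex.sel(2) surjI)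
  thus ?thesis
    by (simp add: filtercomap_neq_bot_surj)
qed

lemma theta_deriv_1_1_tendsto_cusp:
  "((\<lambda>\<tau>. e1 (- \<tau> / 8) * theta_deriv 1 1 \<tau> 0) \<longlongrightarrow> - 2 * of_real pi) (filtercomap Im at_top)"
proof -
  let ?g = "\<lambda>z. e1 ((z + 1/2) / 2) + e1 (- ((z + 1/2) / 2))"
  have ul: "uniform_limit (cball 0 1) (\<lambda>\<tau> z. e1 (- \<tau> / 8) * theta 1 1 \<tau> z) ?g (filtercomap Im at_top)"
    using theta_limit_cusp [of 1 1] by simp
  have ev: "\<forall>\<^sub>F \<tau> in filtercomap Im at_top. continuous_on (cball 0 1) (\<lambda>z. e1 (- \<tau> / 8) * theta 1 1 \<tau> z) \<and>
      (\<forall>z\<in>ball 0 1. ((\<lambda>z. e1 (- \<tau> / 8) * theta 1 1 \<tau> z) has_field_derivative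
         e1 (- \<tau> / 8) * theta_deriv 1 1 \<tau> z) (at z))"
  proof (rule eventually_mono [OF eventually_filtercomapI [OF eventually_gt_at_top [of 0]]], intro conjI ballI)
    fix \<tau> :: complex assume \<tau>: "Im \<tau> > 0"
    show "continuous_on (cball 0 1) (\<lambda>z. e1 (- \<tau> / 8) * theta 1 1 \<tau> z)"
      by (intro continuous_intros continuous_on_subset [OF holomorphic_on_imp_continuous_on [OF theta_holomorphic [OF \<tau>]]]) auto
    show "((\<lambda>z. e1 (- \<tau> / 8) * theta 1 1 \<tau> z) has_field_derivative
         e1 (- \<tau> / 8) * theta_deriv 1 1 \<tau> z) (at z)" for z
      by (intro DERIV_cmult has_field_derivative_theta \<tau>)
  qed
  obtain g' where g': "\<And>w. w \<in> ball 0 1 \<Longrightarrow> (?g has_field_derivative g' w) (at w) \<and>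
      ((\<lambda>\<tau>. e1 (- \<tau> / 8) * theta_deriv 1 1 \<tau> w) \<longlongrightarrow> g' w) (filtercomap Im at_top)"
    by (rule has_complex_derivative_uniform_limit [OF ev ul nontrivial_cusp]) auto
  have "(?g has_field_derivative (of_real pi * \<i> * e1 (1/4) - of_real pi * \<i> * e1 (-1/4))) (at 0)"
    unfolding e1_def by (auto intro!: derivative_eq_intros simp: field_simps)
  moreover have "e1 (- (1/4)) = - \<i>"
  proof -
    have "\<i> * e1 (- (1/4)) = 1"
      using e1_add [of "1/4" "- (1/4)"] by (simp add: e1_quarter)
    hence "- \<i> * (\<i> * e1 (- (1/4))) = - \<i>"
      by simp
    thus ?thesis by (simp add: mult.assoc [symmetric])
  qed
  ultimately have D: "(?g has_field_derivative - 2 * of_real pi) (at 0)"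
    by (simp add: e1_quarter field_simps)
  have g0: "(?g has_field_derivative g' 0) (at 0)"
      "((\<lambda>\<tau>. e1 (- \<tau> / 8) * theta_deriv 1 1 \<tau> 0) \<longlongrightarrow> g' 0) (filtercomap Im at_top)"
    using g' [of 0] by auto
  show ?thesis
    using g0(2) unfolding DERIV_unique [OF g0(1) D] .
qed

lemma filterlim_doubling_cusp:
  assumes "Im \<tau> > 0"
  shows "filterlim (\<lambda>n. 2 ^ n * \<tau>) (filtercomap Im at_top) sequentially"
proof -
  have "Im (2 ^ n * \<tau>) = 2 ^ n * Im \<tau>" for n
    by (metis Im_complex_of_real Im_divide_numeral mult_zero_left add_0 add_0_right Re_complex_of_real
        times_complex.sel(2) of_real_numeral of_real_power)
  moreover have "filterlim (\<lambda>n. 2 ^ n * Im \<tau>) at_top sequentially"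
    using assms by real_asymp
  ultimately show ?thesis
    by (simp add: filterlim_filtercomap_iff o_def)
qed

text \<open>The principle that replaces the theory of modular functions: invariance under
  \<open>\<tau> \<mapsto> 2 \<tau>\<close> lets any point be pushed to the cusp along \<open>2 ^ n * \<tau>\<close>.\<close>

lemma doubling_invariant_eq_limit:
  fixes R :: "complex \<Rightarrow> complex"
  assumes inv: "\<And>\<tau>. Im \<tau> > 0 \<Longrightarrow> R \<tau> = R (2 * \<tau>)"
    and lim: "(R \<longlongrightarrow> c) (filtercomap Im at_top)"
    and \<tau>: "Im \<tau> > 0"
  shows "R \<tau> = c"
proof -
  have "Im (2 ^ n * \<tau>) > 0 \<and> R (2 ^ n * \<tau>) = R \<tau>" for n
  proof (induction n)
    case (Suc n)
    thus ?case using inv [of "2 ^ n * \<tau>"] by (simp add: mult.assoc)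
  qed (use \<tau> in simp)
  hence "(\<lambda>n. R (2 ^ n * \<tau>)) \<longlonglongrightarrow> R \<tau>"
    by simp
  moreover have "(\<lambda>n. R (2 ^ n * \<tau>)) \<longlonglongrightarrow> c"
    by (rule filterlim_compose [OF lim filterlim_doubling_cusp [OF \<tau>]])
  ultimately show ?thesis
    by (rule LIMSEQ_unique)
qed

lemma doubling_nonzero:
  fixes f :: "complex \<Rightarrow> complex"
  assumes step: "\<And>\<tau>. Im \<tau> > 0 \<Longrightarrow> f (2 * \<tau>) \<noteq> 0 \<Longrightarrow> f \<tau> \<noteq> 0"
    and ev: "eventually (\<lambda>\<tau>. f \<tau> \<noteq> 0) (filtercomap Im at_top)"
    and \<tau>: "Im \<tau> > 0"
  shows "f \<tau> \<noteq> 0"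
proof -
  have "Im (2 ^ n * \<tau>) > 0 \<and> (f (2 ^ n * \<tau>) \<noteq> 0 \<longrightarrow> f \<tau> \<noteq> 0)" for n
  proof (induction n)
    case (Suc n)
    thus ?case using step [of "2 ^ n * \<tau>"] by (simp add: mult.assoc)
  qed (use \<tau> in simp)
  moreover have "\<exists>n. f (2 ^ n * \<tau>) \<noteq> 0"
    using eventually_compose_filterlim [OF ev filterlim_doubling_cusp [OF \<tau>]]
    by (auto simp: eventually_sequentially)
  ultimately show ?thesis by blast
qed

section \<open>Theta constants and the Jacobi derivative formula\<close>

abbreviation (input) theta2 :: "complex \<Rightarrow> complex" where "theta2 \<tau> \<equiv> theta 1 0 \<tau> 0"
abbreviation (input) theta3 :: "complex \<Rightarrow> complex" where "theta3 \<tau> \<equiv> theta 0 0 \<tau> 0"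
abbreviation (input) theta4 :: "complex \<Rightarrow> complex" where "theta4 \<tau> \<equiv> theta 0 1 \<tau> 0"

lemma theta_0_minus_1: "theta 0 (-1) \<tau> z = theta 0 1 \<tau> z"
  using theta_delta_add_2 [of 0 "-1" \<tau> z] by simp

lemma theta_1_minus_1: "theta 1 (-1) \<tau> z = - theta 1 1 \<tau> z"
  using theta_delta_add_2 [of 1 "-1" \<tau> z] by (simp add: e1_half)

lemma theta_minus_1: "theta (-1) \<delta> \<tau> z = theta 1 \<delta> \<tau> z"
  using theta_eps_add_2 [of "-1" \<delta> \<tau> z] by simp

lemma theta_2: "theta 2 \<delta> \<tau> z = theta 0 \<delta> \<tau> z"
  using theta_eps_add_2 [of 0 \<delta> \<tau> z] by simp

lemma theta_1_1_odd: "theta 1 1 \<tau> (- z) = - theta 1 1 \<tau> z"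
  using theta_minus [of "-1" "-1" \<tau> z] by (simp add: theta_minus_1 theta_1_minus_1)

lemma theta_1_1_0: "theta 1 1 \<tau> 0 = 0"
  using theta_1_1_odd [of \<tau> 0] by simp

lemma theta2_squared: "Im \<tau> > 0 \<Longrightarrow> (theta2 \<tau>)\<^sup>2 = 2 * theta2 (2 * \<tau>) * theta3 (2 * \<tau>)"
  using theta_mult [of \<tau> 1 0 0 1 0 0] by (simp add: power2_eq_square theta_2)

lemma theta3_mult_theta4: "Im \<tau> > 0 \<Longrightarrow> theta3 \<tau> * theta4 \<tau> = (theta4 (2 * \<tau>))\<^sup>2"
  using theta_mult [of \<tau> 0 0 0 0 1 0] by (simp add: power2_eq_square theta_0_minus_1 theta_1_1_0)

lemma theta4_squared: "Im \<tau> > 0 \<Longrightarrow> (theta4 \<tau>)\<^sup>2 = (theta3 (2 * \<tau>))\<^sup>2 - (theta2 (2 * \<tau>))\<^sup>2"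
  using theta_mult [of \<tau> 0 1 0 0 1 0] theta_delta_add_2 [of 0 0 "2 * \<tau>" 0] theta_delta_add_2 [of 1 0 "2 * \<tau>" 0]
  by (simp add: power2_eq_square e1_half)

text \<open>Suitably normalised, the classical constants tend to nonzero limits at the cusp, and the duplication
  formulas carry nonvanishing from \<open>2 * \<tau>\<close> down to \<open>\<tau>\<close>.\<close>

lemma theta_constants_nonzero:
  assumes "Im \<tau> > 0"
  shows "theta2 \<tau> \<noteq> 0" "theta3 \<tau> \<noteq> 0" "theta4 \<tau> \<noteq> 0"
proof -
  have "theta2 \<tau> * theta3 \<tau> * theta4 \<tau> \<noteq> 0"
  proof (rule doubling_nonzero [OF _ _ assms])
    fix \<tau> :: complex assume "Im \<tau> > 0" "theta2 (2 * \<tau>) * theta3 (2 * \<tau>) * theta4 (2 * \<tau>) \<noteq> 0"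
    thus "theta2 \<tau> * theta3 \<tau> * theta4 \<tau> \<noteq> 0"
      using theta2_squared [of \<tau>] theta3_mult_theta4 [of \<tau>] by auto
  next
    have "((\<lambda>\<tau>. (e1 (- \<tau> / 8) * theta2 \<tau>) * theta3 \<tau> * theta4 \<tau>) \<longlongrightarrow> of_real (2 * cos (pi * 0 / 2)) * 1 * 1)
            (filtercomap Im at_top)"
      by (intro tendsto_mult theta_1_tendsto_cusp theta_0_tendsto_cusp)
    hence "\<forall>\<^sub>F \<tau> in filtercomap Im at_top. (e1 (- \<tau> / 8) * theta2 \<tau>) * theta3 \<tau> * theta4 \<tau> \<noteq> 0"
      by (rule tendsto_imp_eventually_ne) simp
    thus "\<forall>\<^sub>F \<tau> in filtercomap Im at_top. theta2 \<tau> * theta3 \<tau> * theta4 \<tau> \<noteq> 0"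
      by eventually_elim auto
  qed
  thus "theta2 \<tau> \<noteq> 0" "theta3 \<tau> \<noteq> 0" "theta4 \<tau> \<noteq> 0" by auto
qed

lemma has_field_derivative_theta_scaled:
  assumes "Im \<tau> > 0"
  shows "((\<lambda>z. theta \<epsilon> \<delta> \<tau> (c * z)) has_field_derivative c * theta_deriv \<epsilon> \<delta> \<tau> 0) (at 0)"
proof -
  have "((\<lambda>z. theta \<epsilon> \<delta> \<tau> (c * z)) has_field_derivative theta_deriv \<epsilon> \<delta> \<tau> (c * 0) * (c * 1)) (at 0)"
    by (rule DERIV_chain2 [of "theta \<epsilon> \<delta> \<tau>"]) (auto intro!: has_field_derivative_theta assms DERIV_cmult)
  thus ?thesis by (simp add: mult.commute)
qed

text \<open>This is the derivative at \<open>0\<close> of the identity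
  \<open>theta 1 1 \<tau> z * theta 1 0 \<tau> z = theta 1 1 (2 * \<tau>) (2 * z) * theta4 (2 * \<tau>)\<close>.\<close>

lemma theta_deriv_1_1_doubling:
  assumes "Im \<tau> > 0"
  shows "theta_deriv 1 1 \<tau> 0 * theta2 \<tau> = 2 * theta_deriv 1 1 (2 * \<tau>) 0 * theta4 (2 * \<tau>)"
proof -
  have \<tau>2: "Im (2 * \<tau>) > 0" using assms by simp
  have "theta 1 1 \<tau> (1 * z) * theta 1 0 \<tau> (1 * z) = theta 1 1 (2 * \<tau>) (2 * z) * theta4 (2 * \<tau>)" for z
    using theta_mult [OF assms, of 1 1 z 1 0 z] by (simp add: theta_1_1_0)
  moreover have "((\<lambda>z. theta 1 1 \<tau> (1 * z) * theta 1 0 \<tau> (1 * z)) has_field_derivative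
      1 * theta_deriv 1 1 \<tau> 0 * theta 1 0 \<tau> (1 * 0) + 1 * theta_deriv 1 0 \<tau> 0 * theta 1 1 \<tau> (1 * 0)) (at 0)"
    by (intro DERIV_mult has_field_derivative_theta_scaled assms)
  ultimately have "((\<lambda>z. theta 1 1 (2 * \<tau>) (2 * z) * theta4 (2 * \<tau>)) has_field_derivative
      theta_deriv 1 1 \<tau> 0 * theta2 \<tau>) (at 0)"
    by (simp add: theta_1_1_0)
  moreover have "((\<lambda>z. theta 1 1 (2 * \<tau>) (2 * z) * theta4 (2 * \<tau>)) has_field_derivative
      2 * theta_deriv 1 1 (2 * \<tau>) 0 * theta4 (2 * \<tau>)) (at 0)"
    by (intro DERIV_cmult_right has_field_derivative_theta_scaled \<tau>2)
  ultimately show ?thesis by (rule DERIV_unique)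
qed

text \<open>The duplication formulas for the three constants and for the derivative cancel in the
  quotient of the two sides, which is therefore invariant under doubling and equal to its
  limit \<open>- \<pi>\<close> at the cusp.\<close>

lemma Jacobi_derivative_formula:
  assumes "Im \<tau> > 0"
  shows "theta_deriv 1 1 \<tau> 0 = - of_real pi * theta2 \<tau> * theta3 \<tau> * theta4 \<tau>"
proof -
  define R where "R = (\<lambda>\<tau>. theta_deriv 1 1 \<tau> 0 / (theta2 \<tau> * theta3 \<tau> * theta4 \<tau>))"
  have "R \<tau> = - of_real pi"
  proof (rule doubling_invariant_eq_limit [OF _ _ assms])
    fix \<tau> :: complex assume \<tau>: "Im \<tau> > 0"
    hence \<tau>2: "Im (2 * \<tau>) > 0" by simp
    note nz = theta_constants_nonzero [OF \<tau>] theta_constants_nonzero [OF \<tau>2]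
    have "R \<tau> = (theta_deriv 1 1 \<tau> 0 * theta2 \<tau>) / ((theta2 \<tau>)\<^sup>2 * (theta3 \<tau> * theta4 \<tau>))"
      using nz by (simp add: R_def power2_eq_square field_simps)
    also have "\<dots> = R (2 * \<tau>)"
      unfolding theta2_squared [OF \<tau>] theta3_mult_theta4 [OF \<tau>] theta_deriv_1_1_doubling [OF \<tau>]
      using nz by (simp add: R_def power2_eq_square field_simps)
    finally show "R \<tau> = R (2 * \<tau>)" .
  next
    have "((\<lambda>\<tau>. (e1 (- \<tau> / 8) * theta_deriv 1 1 \<tau> 0) / ((e1 (- \<tau> / 8) * theta2 \<tau>) * theta3 \<tau> * theta4 \<tau>))
       \<longlongrightarrow> (- 2 * of_real pi) / (of_real (2 * cos (pi * 0 / 2)) * 1 * 1)) (filtercomap Im at_top)"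
      by (intro tendsto_divide tendsto_mult theta_1_tendsto_cusp theta_0_tendsto_cusp theta_deriv_1_1_tendsto_cusp) simp
    thus "(R \<longlongrightarrow> - of_real pi) (filtercomap Im at_top)"
      by (simp add: R_def mult.assoc)
  qed
  thus ?thesis
    using theta_constants_nonzero [OF assms] by (simp add: R_def field_simps)
qed

section \<open>Logarithmic derivatives under half-period translation\<close>

lemma theta_tau_add_1_const:
  "theta2 (\<tau> + 1) = e1 (1/8) * theta2 \<tau>"
  "theta3 (\<tau> + 1) = theta4 \<tau>"
  "theta4 (\<tau> + 1) = theta3 \<tau>"
proof -
  have "e1 (- 3/8) * e1 (1/2) = e1 (1/8)"
    by (simp flip: e1_add)
  thus "theta2 (\<tau> + 1) = e1 (1/8) * theta2 \<tau>"
    using theta_tau_add_1 [of 1 0 \<tau> 0] theta_delta_add_2 [of 1 0 \<tau> 0] by simp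
  show "theta3 (\<tau> + 1) = theta4 \<tau>"
    using theta_tau_add_1 [of 0 0 \<tau> 0] by simp
  show "theta4 (\<tau> + 1) = theta3 \<tau>"
    using theta_tau_add_1 [of 0 1 \<tau> 0] theta_delta_add_2 [of 0 0 \<tau> 0] by simp
qed

lemma theta_tau_add_2_const:
  "theta2 (\<tau> + 2) = \<i> * theta2 \<tau>"
  "theta3 (\<tau> + 2) = theta3 \<tau>"
proof -
  have "\<tau> + 2 = (\<tau> + 1) + 1" by simp
  moreover have "e1 (1/8) * e1 (1/8) = \<i>"
    using e1_add [of "1/8" "1/8"] by (simp add: e1_quarter)
  ultimately show "theta2 (\<tau> + 2) = \<i> * theta2 \<tau>" "theta3 (\<tau> + 2) = theta3 \<tau>"
    by (simp_all only: theta_tau_add_1_const mult.assoc [symmetric])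
qed

lemma theta_tau_add_4_const:
  "theta2 (\<tau> + 4) = - theta2 \<tau>"
  "theta3 (\<tau> + 4) = theta3 \<tau>"
  using theta_tau_add_2_const [of "\<tau> + 2"] theta_tau_add_2_const [of \<tau>]
  by (simp_all add: add.assoc)

text \<open>For \<open>c \<noteq> 0\<close> the logarithmic derivatives agree, which transports the final formulas
  between equivalent characteristics.\<close>

lemma theta_deriv_cong_cmult:
  assumes "Im \<tau>' > 0" and "\<And>z. theta \<epsilon> \<delta> \<tau> z = c * theta \<epsilon>' \<delta>' \<tau>' z"
  shows "theta_deriv \<epsilon> \<delta> \<tau> z = c * theta_deriv \<epsilon>' \<delta>' \<tau>' z"
proof -
  have "theta \<epsilon> \<delta> \<tau> = (\<lambda>z. c * theta \<epsilon>' \<delta>' \<tau>' z)"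
    using assms(2) by (rule ext)
  moreover have "((\<lambda>z. c * theta \<epsilon>' \<delta>' \<tau>' z) has_field_derivative c * theta_deriv \<epsilon>' \<delta>' \<tau>' z) (at z)"
    by (intro DERIV_cmult has_field_derivative_theta assms(1))
  ultimately show ?thesis
    by (simp add: theta_deriv_def [of \<epsilon> \<delta> \<tau>] DERIV_imp_deriv)
qed

lemma log_deriv_tau_add_1:
  assumes "Im \<tau> > 0" and "theta_deriv \<epsilon> \<delta> (\<tau> + 1) 0 = X * theta \<epsilon> \<delta> (\<tau> + 1) 0"
    and "\<delta>' = \<delta> + 1 + \<epsilon>"
  shows "theta_deriv \<epsilon> \<delta>' \<tau> 0 = X * theta \<epsilon> \<delta>' \<tau> 0"
  using assms(2) theta_deriv_cong_cmult [OF assms(1) theta_tau_add_1, of \<epsilon> \<delta> 0] theta_tau_add_1 [of \<epsilon> \<delta> \<tau> 0]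
  by (simp add: assms(3))

lemma log_deriv_delta_add_2:
  assumes "Im \<tau> > 0" and "theta_deriv \<epsilon> (\<delta> + 2) \<tau> 0 = X * theta \<epsilon> (\<delta> + 2) \<tau> 0"
  shows "theta_deriv \<epsilon> \<delta> \<tau> 0 = X * theta \<epsilon> \<delta> \<tau> 0"
  using assms(2) theta_deriv_cong_cmult [OF assms(1) theta_delta_add_2, of \<epsilon> \<delta> 0] theta_delta_add_2 [of \<epsilon> \<delta> \<tau> 0]
  by simp

lemma theta_mult_delta_add_1:
  assumes "Im \<tau> > 0"
  shows "theta \<epsilon> \<delta> \<tau> z * theta \<epsilon> (\<delta> + 1) \<tau> z = theta \<epsilon> (2 * \<delta> + 1) (2 * \<tau>) (2 * z) * theta4 (2 * \<tau>)"
proof -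
  have "\<delta> + (\<delta> + 1) = 2 * \<delta> + 1" "\<delta> - (\<delta> + 1) = -1" "z + z = 2 * z" "(\<epsilon> + \<epsilon>) / 2 = \<epsilon>" by simp_all
  thus ?thesis
    using theta_mult [OF assms, of \<epsilon> \<delta> z \<epsilon> "\<delta> + 1" z]
    by (simp only: theta_0_minus_1 theta_1_minus_1 theta_1_1_0 diff_self div_0 add_0 minus_zero mult_zero_right add_0_right)
qed

text \<open>Adding 1 to \<open>\<delta>\<close> is a translation of \<open>z\<close> by \<open>1/2\<close>. The product of the two translates
  is, up to a constant, a single theta function of \<open>2 * \<tau>\<close>, so the sum of the two logarithmic derivatives is one as well.\<close>

lemma theta_deriv_sum_half_period:
  assumes "Im \<tau> > 0"
  shows "theta_deriv \<epsilon> \<delta> \<tau> 0 * theta \<epsilon> (\<delta> + 1) \<tau> 0 + theta_deriv \<epsilon> (\<delta> + 1) \<tau> 0 * theta \<epsilon> \<delta> \<tau> 0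
       = 2 * theta_deriv \<epsilon> (2 * \<delta> + 1) (2 * \<tau>) 0 * theta4 (2 * \<tau>)"
proof -
  have \<tau>2: "Im (2 * \<tau>) > 0" using assms by simp
  have "((\<lambda>z. theta \<epsilon> \<delta> \<tau> (1 * z) * theta \<epsilon> (\<delta> + 1) \<tau> (1 * z)) has_field_derivative
      1 * theta_deriv \<epsilon> \<delta> \<tau> 0 * theta \<epsilon> (\<delta> + 1) \<tau> (1 * 0) + 1 * theta_deriv \<epsilon> (\<delta> + 1) \<tau> 0 * theta \<epsilon> \<delta> \<tau> (1 * 0)) (at 0)"
    by (intro DERIV_mult has_field_derivative_theta_scaled assms)
  moreover have "((\<lambda>z. theta \<epsilon> (2 * \<delta> + 1) (2 * \<tau>) (2 * z) * theta4 (2 * \<tau>)) has_field_derivative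
      2 * theta_deriv \<epsilon> (2 * \<delta> + 1) (2 * \<tau>) 0 * theta4 (2 * \<tau>)) (at 0)"
    by (intro DERIV_cmult_right has_field_derivative_theta_scaled \<tau>2)
  ultimately show ?thesis
    using DERIV_unique by (simp add: theta_mult_delta_add_1 [OF assms]) blast
qed

lemma theta_deriv_0_1: 
  assumes "Im \<tau> > 0"
  shows "theta_deriv 0 1 \<tau> 0 = 0"
proof -
  have "theta 0 1 \<tau> (-1 * z) = theta 0 1 \<tau> z" for z
    using theta_minus [of 0 "-1" \<tau> z] by (simp add: theta_0_minus_1)
  hence "(theta 0 1 \<tau> has_field_derivative -1 * theta_deriv 0 1 \<tau> 0) (at 0)"
    using has_field_derivative_theta_scaled [OF assms, of 0 1 "-1"] by presburger
  hence "-1 * theta_deriv 0 1 \<tau> 0 = theta_deriv 0 1 \<tau> 0"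
    using has_field_derivative_theta [OF assms] by (rule DERIV_unique)
  thus ?thesis by simp
qed

text \<open>Here the second factor is taken at \<open>- z\<close>. The product formula then yields a combination
  of \<open>theta 0 1\<close> and \<open>theta 1 1\<close> at \<open>2 * z\<close>; the first is even, so that the derivative at \<open>0\<close>
  only sees the second, which Jacobi's formula evaluates.\<close>

lemma theta_deriv_diff_half_period:
  assumes "Im \<tau> > 0"
  shows "theta_deriv \<epsilon> \<delta> \<tau> 0 * theta \<epsilon> (\<delta> + 1) \<tau> 0 - theta_deriv \<epsilon> (\<delta> + 1) \<tau> 0 * theta \<epsilon> \<delta> \<tau> 0
       = 2 * of_real pi * theta (\<epsilon> + 1) (2 * \<delta> + 1) (2 * \<tau>) 0 * theta2 (2 * \<tau>) * theta3 (2 * \<tau>) * theta4 (2 * \<tau>)"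
proof -
  have \<tau>2: "Im (2 * \<tau>) > 0" using assms by simp
  let ?A = "theta \<epsilon> (2 * \<delta> + 1) (2 * \<tau>) 0" and ?B = "theta (\<epsilon> + 1) (2 * \<delta> + 1) (2 * \<tau>) 0"
  have eq: "theta \<epsilon> \<delta> \<tau> (1 * z) * theta \<epsilon> (\<delta> + 1) \<tau> (-1 * z)
      = ?A * theta 0 1 (2 * \<tau>) (2 * z) - ?B * theta 1 1 (2 * \<tau>) (2 * z)" for z
  proof -
    have "\<delta> + (\<delta> + 1) = 2 * \<delta> + 1" "\<delta> - (\<delta> + 1) = -1" "1 * z + (-1 * z) = 0" "1 * z - (-1 * z) = 2 * z" "(\<epsilon> + \<epsilon>) / 2 = \<epsilon>"
      by simp_all
    thus ?thesis
      using theta_mult [OF assms, of \<epsilon> \<delta> "1 * z" \<epsilon> "\<delta> + 1" "-1 * z"]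
      by (simp only: theta_0_minus_1 theta_1_minus_1 diff_self div_0 add_0 mult_minus_right diff_conv_add_uminus)
  qed
  have "((\<lambda>z. theta \<epsilon> \<delta> \<tau> (1 * z) * theta \<epsilon> (\<delta> + 1) \<tau> (-1 * z)) has_field_derivative
      1 * theta_deriv \<epsilon> \<delta> \<tau> 0 * theta \<epsilon> (\<delta> + 1) \<tau> (-1 * 0) + -1 * theta_deriv \<epsilon> (\<delta> + 1) \<tau> 0 * theta \<epsilon> \<delta> \<tau> (1 * 0)) (at 0)"
    by (intro DERIV_mult has_field_derivative_theta_scaled assms)
  moreover have "((\<lambda>z. ?A * theta 0 1 (2 * \<tau>) (2 * z) - ?B * theta 1 1 (2 * \<tau>) (2 * z)) has_field_derivative
      ?A * (2 * theta_deriv 0 1 (2 * \<tau>) 0) - ?B * (2 * theta_deriv 1 1 (2 * \<tau>) 0)) (at 0)"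
    by (intro DERIV_diff DERIV_cmult has_field_derivative_theta_scaled \<tau>2)
  ultimately have "1 * theta_deriv \<epsilon> \<delta> \<tau> 0 * theta \<epsilon> (\<delta> + 1) \<tau> (-1 * 0) + -1 * theta_deriv \<epsilon> (\<delta> + 1) \<tau> 0 * theta \<epsilon> \<delta> \<tau> (1 * 0)
      = ?A * (2 * theta_deriv 0 1 (2 * \<tau>) 0) - ?B * (2 * theta_deriv 1 1 (2 * \<tau>) 0)"
    unfolding eq by (rule DERIV_unique)
  thus ?thesis
    by (simp add: theta_deriv_0_1 [OF \<tau>2] Jacobi_derivative_formula [OF \<tau>2])
qed

text \<open>Half the sum plus half the difference of the logarithmic derivatives at the two translates.
  The number \<open>L\<close> is a logarithmic derivative of the same type at \<open>2 * \<tau>\<close> with a simpler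
  characteristic, and \<open>M\<close> is a quotient of theta constants.\<close>

lemma log_deriv_descent:
  assumes \<tau>: "Im \<tau> > 0"
    and lam: "theta_deriv \<epsilon> (2 * \<delta> + 1) (2 * \<tau>) 0 = L * theta \<epsilon> (2 * \<delta> + 1) (2 * \<tau>) 0"
    and mu: "theta2 (2 * \<tau>) * theta3 (2 * \<tau>) * theta (\<epsilon> + 1) (2 * \<delta> + 1) (2 * \<tau>) 0 = M * theta \<epsilon> (2 * \<delta> + 1) (2 * \<tau>) 0"
    and nz: "theta \<epsilon> (2 * \<delta> + 1) (2 * \<tau>) 0 \<noteq> 0"
  shows "theta_deriv \<epsilon> \<delta> \<tau> 0 = (L + of_real pi * M) * theta \<epsilon> \<delta> \<tau> 0"
proof -
  let ?T = "theta \<epsilon> (2 * \<delta> + 1) (2 * \<tau>) 0"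
  have prod: "theta \<epsilon> \<delta> \<tau> 0 * theta \<epsilon> (\<delta> + 1) \<tau> 0 = ?T * theta4 (2 * \<tau>)"
    using theta_mult_delta_add_1 [OF \<tau>, of \<epsilon> \<delta> 0] by simp
  hence nz': "theta \<epsilon> (\<delta> + 1) \<tau> 0 \<noteq> 0"
    using nz theta_constants_nonzero(3) [of "2 * \<tau>"] \<tau> by auto
  have "2 * (theta_deriv \<epsilon> \<delta> \<tau> 0 * theta \<epsilon> (\<delta> + 1) \<tau> 0)
      = 2 * theta_deriv \<epsilon> (2 * \<delta> + 1) (2 * \<tau>) 0 * theta4 (2 * \<tau>)
        + 2 * of_real pi * theta (\<epsilon> + 1) (2 * \<delta> + 1) (2 * \<tau>) 0 * theta2 (2 * \<tau>) * theta3 (2 * \<tau>) * theta4 (2 * \<tau>)"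
    unfolding theta_deriv_sum_half_period [OF \<tau>, symmetric] theta_deriv_diff_half_period [OF \<tau>, symmetric] by simp
  also have "\<dots> = 2 * (theta_deriv \<epsilon> (2 * \<delta> + 1) (2 * \<tau>) 0 
      + of_real pi * (theta2 (2 * \<tau>) * theta3 (2 * \<tau>) * theta (\<epsilon> + 1) (2 * \<delta> + 1) (2 * \<tau>) 0)) * theta4 (2 * \<tau>)"
    by (simp add: algebra_simps)
  also have "\<dots> = 2 * ((L + of_real pi * M) * (?T * theta4 (2 * \<tau>)))"
    unfolding lam mu by (simp add: algebra_simps)
  also have "\<dots> = 2 * ((L + of_real pi * M) * theta \<epsilon> \<delta> \<tau> 0 * theta \<epsilon> (\<delta> + 1) \<tau> 0)"
    unfolding prod [symmetric] by simp
  finally show ?thesis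
    using nz' by simp
qed

section \<open>Characteristics with vanishing first entry\<close>

lemma theta_0_3_2: 
  assumes "Im \<tau> > 0"
  shows "theta 0 (3/2) \<tau> z = theta 0 1 (4 * \<tau>) (2 * z) - theta 1 1 (4 * \<tau>) (2 * z)"
  using theta_dissect [OF assms, of 0 "3/2" z] theta_delta_add_2 [of _ 1 "4 * \<tau>" "2 * z"]
  by (simp add: e1_half)

lemma theta_0_3_2_const: "Im \<tau> > 0 \<Longrightarrow> theta 0 (3/2) \<tau> 0 = theta4 (4 * \<tau>)"
  by (simp add: theta_0_3_2 theta_1_1_0)

lemma filterlim_numeral_mult_cusp:
  "filterlim (\<lambda>\<tau>. numeral k * \<tau>) (filtercomap Im at_top) (filtercomap Im at_top)"
proof -
  have "filterlim (\<lambda>y::real. numeral k * y) at_top at_top"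
    by real_asymp
  hence "filterlim (\<lambda>\<tau>. numeral k * Im \<tau>) at_top (filtercomap Im at_top)"
    by (rule filterlim_compose) (rule filterlim_filtercomap)
  thus ?thesis
    by (simp add: filterlim_filtercomap_iff o_def)
qed

text \<open>This determines the constant at the quarter-period in terms of classical ones. Squaring
  and applying duplication formulas would leave the sign open. Instead, the quotient \<open>R\<close>
  is shown to be invariant under doubling; its limit at the cusp is \<open>cos (3 \<pi> / 4)\<close>.\<close>

lemma theta_1_3_2_const:
  assumes "Im \<tau> > 0"
  shows "theta 1 (3/2) \<tau> 0 * theta4 (4 * \<tau>) = - (of_real (sqrt 2) / 2) * theta4 (2 * \<tau>) * theta2 \<tau>"
proof -
  let ?T = "\<lambda>\<tau>. theta 1 (3/2) \<tau> 0"
  define R where "R = (\<lambda>\<tau>. (?T \<tau> * theta4 (4 * \<tau>)) / (theta4 (2 * \<tau>) * theta2 \<tau>))"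
  have "R \<tau> = - (of_real (sqrt 2) / 2)"
  proof (rule doubling_invariant_eq_limit [OF _ _ assms])
    fix \<tau> :: complex assume \<tau>: "Im \<tau> > 0"
    hence \<tau>2: "Im (2 * \<tau>) > 0" and \<tau>4: "Im (4 * \<tau>) > 0" by simp_all
    note nz = theta_constants_nonzero [OF \<tau>] theta_constants_nonzero [OF \<tau>2] theta_constants_nonzero [OF \<tau>4]
    have T: "?T \<tau> * theta2 \<tau> = 2 * ?T (2 * \<tau>) * theta4 (8 * \<tau>)"
      using theta_mult [OF \<tau>, of 1 "3/2" 0 1 0 0] theta_0_3_2_const [OF \<tau>2] by (simp add: theta_2)
    have 34: "theta3 (2 * \<tau>) * theta4 (2 * \<tau>) = (theta4 (4 * \<tau>))\<^sup>2"
      using theta3_mult_theta4 [OF \<tau>2] by simp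
    have "R \<tau> = (?T \<tau> * theta2 \<tau>) * theta4 (4 * \<tau>) / (theta4 (2 * \<tau>) * (theta2 \<tau>)\<^sup>2)"
      using nz by (simp add: R_def power2_eq_square field_simps)
    also have "\<dots> = ?T (2 * \<tau>) * theta4 (8 * \<tau>) * theta4 (4 * \<tau>) / (theta2 (2 * \<tau>) * (theta3 (2 * \<tau>) * theta4 (2 * \<tau>)))"
      unfolding T theta2_squared [OF \<tau>] using nz by (simp add: field_simps)
    also have "\<dots> = R (2 * \<tau>)"
      unfolding 34 using nz by (simp add: R_def power2_eq_square field_simps)
    finally show "R \<tau> = R (2 * \<tau>)" .
  next
    have "cos (pi * (3/2) / 2) = - cos (pi / 4)"
      using cos_pi_minus [of "pi / 4"] by (simp add: field_simps)
    hence c: "cos (pi * (3/2) / 2) = - (sqrt 2 / 2)"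
      by (simp add: cos_45)
    have "((\<lambda>\<tau>. (e1 (- \<tau> / 8) * ?T \<tau>) * theta4 (4 * \<tau>) / (theta4 (2 * \<tau>) * (e1 (- \<tau> / 8) * theta2 \<tau>)))
       \<longlongrightarrow> of_real (2 * cos (pi * (3/2) / 2)) * 1 / (1 * of_real (2 * cos (pi * 0 / 2)))) (filtercomap Im at_top)"
      by (intro tendsto_divide tendsto_mult theta_1_tendsto_cusp
            filterlim_compose [OF theta_0_tendsto_cusp filterlim_numeral_mult_cusp]) simp
    thus "(R \<longlongrightarrow> - (of_real (sqrt 2) / 2)) (filtercomap Im at_top)"
      unfolding c by (simp add: R_def mult_ac)
  qed
  thus ?thesis
    using theta_constants_nonzero [of \<tau>] theta_constants_nonzero [of "2 * \<tau>"] assms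
    by (simp add: R_def field_simps)
qed

text \<open>Here \<open>2 * \<delta> + 1 = 3/2\<close>. By dissection, \<open>theta 0 (3/2) (2 * \<tau>)\<close> is a difference of an
  even and an odd classical theta function of \<open>8 * \<tau>\<close>, whence \<open>L\<close> by Jacobi's formula; \<open>M\<close> comes
  from the quarter-period constant.\<close>

lemma log_deriv_0_1_4:
  assumes "Im \<tau> > 0"
  shows "theta_deriv 0 (1/4) \<tau> 0 = - of_real pi * (of_real (sqrt 2) * theta3 (2 * \<tau>) * theta2 (4 * \<tau>)
           - (theta2 (4 * \<tau>))\<^sup>2) * theta 0 (1/4) \<tau> 0"
proof -
  have \<tau>2: "Im (2 * \<tau>) > 0" and \<tau>4: "Im (4 * \<tau>) > 0" and \<tau>8: "Im (8 * \<tau>) > 0" using assms by simp_all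
  have T: "theta 0 (3/2) (2 * \<tau>) 0 = theta4 (8 * \<tau>)"
    using theta_0_3_2_const [OF \<tau>2] by simp
  have nz: "theta4 (8 * \<tau>) \<noteq> 0"
    by (rule theta_constants_nonzero [OF \<tau>8])
  have sq4: "(theta2 (4 * \<tau>))\<^sup>2 = 2 * theta2 (8 * \<tau>) * theta3 (8 * \<tau>)"
    using theta2_squared [OF \<tau>4] by simp
  have sq2: "(theta2 (2 * \<tau>))\<^sup>2 = 2 * theta2 (4 * \<tau>) * theta3 (4 * \<tau>)"
    using theta2_squared [OF \<tau>2] by simp
  have sq34: "theta3 (4 * \<tau>) * theta4 (4 * \<tau>) = (theta4 (8 * \<tau>))\<^sup>2"
    using theta3_mult_theta4 [OF \<tau>4] by simp
  have expand: "theta 0 (3/2) (2 * \<tau>) = (\<lambda>z. theta 0 1 (8 * \<tau>) (2 * z) - theta 1 1 (8 * \<tau>) (2 * z))"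
    using theta_0_3_2 [OF \<tau>2] by (intro ext) simp
  have "((\<lambda>z. theta 0 1 (8 * \<tau>) (2 * z) - theta 1 1 (8 * \<tau>) (2 * z)) has_field_derivative
      2 * theta_deriv 0 1 (8 * \<tau>) 0 - 2 * theta_deriv 1 1 (8 * \<tau>) 0) (at 0)"
    by (intro DERIV_diff has_field_derivative_theta_scaled \<tau>8)
  hence "(theta 0 (3/2) (2 * \<tau>) has_field_derivative
      2 * theta_deriv 0 1 (8 * \<tau>) 0 - 2 * theta_deriv 1 1 (8 * \<tau>) 0) (at 0)"
    by (simp only: expand)
  hence "theta_deriv 0 (3/2) (2 * \<tau>) 0 = 2 * theta_deriv 0 1 (8 * \<tau>) 0 - 2 * theta_deriv 1 1 (8 * \<tau>) 0"
    by (rule DERIV_unique [OF has_field_derivative_theta [OF \<tau>2]])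
  hence L: "theta_deriv 0 (3/2) (2 * \<tau>) 0 = of_real pi * (theta2 (4 * \<tau>))\<^sup>2 * theta4 (8 * \<tau>)"
    by (simp add: theta_deriv_0_1 [OF \<tau>8] Jacobi_derivative_formula [OF \<tau>8] sq4)
  have "theta2 (2 * \<tau>) * theta3 (2 * \<tau>) * theta 1 (3/2) (2 * \<tau>) 0 * theta4 (8 * \<tau>)
      = theta2 (2 * \<tau>) * theta3 (2 * \<tau>) * (theta 1 (3/2) (2 * \<tau>) 0 * theta4 (8 * \<tau>))"
    by simp
  also have "\<dots> = - (of_real (sqrt 2) / 2) * theta3 (2 * \<tau>) * theta4 (4 * \<tau>) * (theta2 (2 * \<tau>))\<^sup>2"
    using theta_1_3_2_const [OF \<tau>2] by (simp add: power2_eq_square)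
  also have "\<dots> = - of_real (sqrt 2) * theta3 (2 * \<tau>) * theta2 (4 * \<tau>) * (theta3 (4 * \<tau>) * theta4 (4 * \<tau>))"
    unfolding sq2 by simp
  also have "\<dots> = - of_real (sqrt 2) * theta3 (2 * \<tau>) * theta2 (4 * \<tau>) * theta4 (8 * \<tau>) * theta4 (8 * \<tau>)"
    unfolding sq34 by (simp add: power2_eq_square)
  finally have M: "theta2 (2 * \<tau>) * theta3 (2 * \<tau>) * theta 1 (3/2) (2 * \<tau>) 0
      = - of_real (sqrt 2) * theta3 (2 * \<tau>) * theta2 (4 * \<tau>) * theta4 (8 * \<tau>)"
    by (rule mult_right_cancel [OF nz, THEN iffD1])
  have "theta_deriv 0 (1/4) \<tau> 0 = (of_real pi * (theta2 (4 * \<tau>))\<^sup>2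
      + of_real pi * (- of_real (sqrt 2) * theta3 (2 * \<tau>) * theta2 (4 * \<tau>))) * theta 0 (1/4) \<tau> 0"
    by (rule log_deriv_descent) (use assms nz L M T in simp_all)
  thus ?thesis by (simp add: algebra_simps)
qed

text \<open>Replacing \<open>\<tau>\<close> by \<open>\<tau> + 1\<close> turns \<open>\<delta> = 1/4\<close> into \<open>5/4\<close>, which is equivalent to \<open>- 3/4\<close>;
  the reflection \<open>z \<mapsto> - z\<close> then changes the sign of the logarithmic derivative.\<close>

lemma log_deriv_0_3_4:
  assumes "Im \<tau> > 0"
  shows "theta_deriv 0 (3/4) \<tau> 0 = - of_real pi * (of_real (sqrt 2) * theta3 (2 * \<tau>) * theta2 (4 * \<tau>)
           + (theta2 (4 * \<tau>))\<^sup>2) * theta 0 (3/4) \<tau> 0"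
proof -
  let ?X = "- of_real pi * (of_real (sqrt 2) * theta3 (2 * \<tau>) * theta2 (4 * \<tau>) + (theta2 (4 * \<tau>))\<^sup>2)"
  have arg: "2 * (\<tau> + 1) = 2 * \<tau> + 2" "4 * (\<tau> + 1) = 4 * \<tau> + 4" by simp_all
  have "theta_deriv 0 (1/4) (\<tau> + 1) 0 = - ?X * theta 0 (1/4) (\<tau> + 1) 0"
    using log_deriv_0_1_4 [of "\<tau> + 1"] assms unfolding arg theta_tau_add_2_const theta_tau_add_4_const
    by (simp add: algebra_simps)
  hence "theta_deriv 0 (5/4) \<tau> 0 = - ?X * theta 0 (5/4) \<tau> 0"
    by (rule log_deriv_tau_add_1 [OF assms]) simp
  hence "theta_deriv 0 (-3/4) \<tau> 0 = - ?X * theta 0 (-3/4) \<tau> 0"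
    using log_deriv_delta_add_2 [OF assms, of 0 "-3/4"] by simp
  moreover have neg: "theta 0 (-3/4) \<tau> z = theta 0 (3/4) \<tau> (-1 * z)" for z
    using theta_minus [of 0 "3/4" \<tau> "- z"] by simp
  moreover have "theta_deriv 0 (-3/4) \<tau> 0 = -1 * theta_deriv 0 (3/4) \<tau> 0"
  proof (rule DERIV_unique [OF has_field_derivative_theta [OF assms]])
    show "(theta 0 (-3/4) \<tau> has_field_derivative -1 * theta_deriv 0 (3/4) \<tau> 0) (at 0)"
      unfolding neg [abs_def] by (rule has_field_derivative_theta_scaled [OF assms])
  qed
  ultimately show ?thesis by simp
qed

section \<open>Characteristics with first entry one half\<close>

lemma theta_half_minus: "theta (3/2) 0 \<tau> z = theta (1/2) 0 \<tau> (- z)"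
  using theta_minus [of "-1/2" 0 \<tau> z] theta_eps_add_2 [of "-1/2" 0 \<tau> z] by simp

lemma theta2_dissect_half:
  assumes "Im \<tau> > 0"
  shows "theta2 \<tau> = 2 * theta (1/2) 0 (4 * \<tau>) 0"
  using theta_dissect [OF assms, of 1 0 0] by (simp add: theta_half_minus)

lemma theta_half_0_nonzero:
  assumes "Im \<tau> > 0"
  shows "theta (1/2) 0 \<tau> 0 \<noteq> 0"
  using theta2_dissect_half [of "\<tau> / 4"] theta_constants_nonzero(1) [of "\<tau> / 4"] assms by auto

text \<open>Together with the corresponding expression of \<open>theta 1 0\<close>, this shows that the even and
  odd parts of \<open>theta (1/2) 0\<close> are classical theta functions.\<close>

lemma theta_1_1_dissect_half:
  assumes "Im \<tau> > 0"
  shows "theta 1 1 \<tau> z = \<i> * (theta (1/2) 0 (4 * \<tau>) (2 * z) - theta (1/2) 0 (4 * \<tau>) (- 2 * z))"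
proof -
  have "theta 1 1 \<tau> z = theta (1/2) (0 + 2) (4 * \<tau>) (2 * z) + theta (3/2) (0 + 2) (4 * \<tau>) (2 * z)"
    using theta_dissect [OF assms, of 1 1 z] by simp
  also have "\<dots> = \<i> * theta (1/2) 0 (4 * \<tau>) (2 * z) - \<i> * theta (3/2) 0 (4 * \<tau>) (2 * z)"
    unfolding theta_delta_add_2 by (simp add: e1_quarter e1_3_quarters)
  finally show ?thesis
    by (simp add: theta_half_minus algebra_simps)
qed

text \<open>The derivative of \<open>theta (1/2) 0\<close> at \<open>0\<close> is that of its odd part, so Jacobi's formula
  at \<open>\<tau> / 4\<close> evaluates it; the duplication formulas return from \<open>\<tau> / 4\<close> to \<open>\<tau>\<close>.\<close>

lemma log_deriv_half_0:
  assumes "Im \<tau> > 0"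
  shows "theta_deriv (1/2) 0 \<tau> 0 = of_real pi * \<i> / 2 * ((theta3 \<tau>)\<^sup>2 - (theta2 \<tau>)\<^sup>2) * theta (1/2) 0 \<tau> 0"
proof -
  define s where "s = \<tau> / 4"
  have \<tau>: "\<tau> = 4 * s" and s: "Im s > 0" and s2: "Im (2 * s) > 0" and s4: "Im (4 * s) > 0"
    using assms by (simp_all add: s_def)
  let ?D = "theta_deriv (1/2) 0 (4 * s) 0"
  have "((\<lambda>z. \<i> * (theta (1/2) 0 (4 * s) (2 * z) - theta (1/2) 0 (4 * s) (- 2 * z))) has_field_derivative
      \<i> * (2 * ?D - - 2 * ?D)) (at 0)"
    by (intro DERIV_cmult DERIV_diff has_field_derivative_theta_scaled s4)
  hence "(theta 1 1 s has_field_derivative \<i> * (2 * ?D - - 2 * ?D)) (at 0)"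
    by (simp only: theta_1_1_dissect_half [OF s, abs_def])
  hence "\<i> * (2 * ?D - - 2 * ?D) = theta_deriv 1 1 s 0"
    using has_field_derivative_theta [OF s] by (rule DERIV_unique)
  also have "\<dots> = - of_real pi * theta2 s * (theta3 s * theta4 s)"
    by (simp add: Jacobi_derivative_formula [OF s])
  also have "\<dots> = - 2 * of_real pi * ((theta3 (4 * s))\<^sup>2 - (theta2 (4 * s))\<^sup>2) * theta (1/2) 0 (4 * s) 0"
    unfolding theta3_mult_theta4 [OF s] theta4_squared [OF s2] theta2_dissect_half [OF s] by simp
  finally have "4 * \<i> * ?D = - 2 * of_real pi * ((theta3 (4 * s))\<^sup>2 - (theta2 (4 * s))\<^sup>2) * theta (1/2) 0 (4 * s) 0"
    by simp
  hence "- (\<i> / 4) * (4 * \<i> * ?D) = - (\<i> / 4) * (- 2 * of_real pi * ((theta3 (4 * s))\<^sup>2 - (theta2 (4 * s))\<^sup>2) * theta (1/2) 0 (4 * s) 0)"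
    by (rule arg_cong)
  thus ?thesis
    unfolding \<tau> by simp
qed

text \<open>At \<open>\<kappa> = 2 * \<tau> + 1\<close> the two values become, up to roots of unity, those with
  characteristics \<open>(3/2, -1)\<close> and \<open>(1/2, 0)\<close>. Dissection identifies these with the
  constants \<open>theta 1 (3/2)\<close> and \<open>theta2\<close> at \<open>\<kappa> / 4\<close>, whose ratio is known.\<close>

lemma theta_half_3_2_ratio:
  assumes "Im \<tau> > 0"
  shows "theta3 (2 * \<tau>) * theta (3/2) (3/2) (2 * \<tau>) 0
     = - (\<i> * of_real (sqrt 2) / 2) * (theta4 \<tau> - \<i> * theta3 \<tau>) * theta (1/2) (3/2) (2 * \<tau>) 0"
proof -
  define \<kappa> where "\<kappa> = 2 * \<tau> + 1"
  have k: "Im \<kappa> > 0" and k4: "Im (\<kappa> / 4) > 0" and k2: "Im (\<kappa> / 2) > 0" using assms by (simp_all add: \<kappa>_def)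
  let ?U = "theta (3/2) (-1) \<kappa> 0" and ?V = "theta (1/2) 0 \<kappa> 0"
  have "theta 1 (3/2) (\<kappa> / 4) 0 = (\<i> - 1) * ?U"
  proof -
    have "theta (1/2) 3 \<kappa> 0 = \<i> * ?U"
    proof -
      have "?U = e1 (3/4) * theta (3/2) (-3) \<kappa> 0"
        using theta_delta_add_2 [of "3/2" "-3" \<kappa> 0] by simp
      also have "theta (3/2) (-3) \<kappa> 0 = theta (1/2) 3 \<kappa> 0"
        using theta_minus [of "1/2" 3 \<kappa> 0] theta_eps_add_2 [of "-1/2" "-3" \<kappa> 0] by simp
      finally show ?thesis
        by (simp add: e1_3_quarters)
    qed
    moreover have "theta (3/2) 3 \<kappa> 0 = - ?U"
    proof -
      have "theta (3/2) (-1 + 2 + 2) \<kappa> 0 = - ?U"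
        unfolding theta_delta_add_2 by (simp add: e1_3_quarters)
      thus ?thesis by simp
    qed
    ultimately show ?thesis
      using theta_dissect [OF k4, of 1 "3/2" 0] by (simp add: algebra_simps)
  qed
  moreover have "theta2 (\<kappa> / 4) = 2 * ?V"
    using theta2_dissect_half [OF k4] by simp
  ultimately have "(\<i> - 1) * ?U * theta4 \<kappa> = - of_real (sqrt 2) * theta4 (\<kappa> / 2) * ?V"
    using theta_1_3_2_const [OF k4] by simp
  moreover have "theta4 \<kappa> = theta3 (2 * \<tau>)"
    unfolding \<kappa>_def by (rule theta_tau_add_1_const)
  moreover have "theta4 (\<kappa> / 2) = (1 + \<i>) / 2 * (theta4 \<tau> - \<i> * theta3 \<tau>)"
  proof -
    have t3: "theta3 \<tau> = theta3 (4 * \<tau>) + theta2 (4 * \<tau>)"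
      using theta_dissect [OF assms, of 0 0 0] by simp
    have t4: "theta4 \<tau> = theta3 (4 * \<tau>) - theta2 (4 * \<tau>)" if "Im \<tau> > 0" for \<tau>
      using theta_dissect [OF that, of 0 1 0] theta_delta_add_2 [of _ 0 "4 * \<tau>" 0] by (simp add: e1_half)
    have "4 * (\<kappa> / 2) = 4 * \<tau> + 2" by (simp add: \<kappa>_def)
    hence "theta4 (\<kappa> / 2) = theta3 (4 * \<tau>) - \<i> * theta2 (4 * \<tau>)"
      using t4 [OF k2] by (simp only: theta_tau_add_2_const)
    moreover have "(1 + \<i>) / 2 * ((a - b) - \<i> * (a + b)) = a - \<i> * b" for a b
      by (simp add: complex_eq_iff field_simps)
    ultimately show ?thesis
      unfolding t3 t4 [OF assms] by (simp only:)
  qed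
  moreover obtain c where c: "c \<noteq> 0" "?V = - c * theta (1/2) (3/2) (2 * \<tau>) 0" "?U = c * theta (3/2) (3/2) (2 * \<tau>) 0"
  proof
    \<comment> \<open>The factors of the shift at \<open>\<epsilon> = 1/2\<close> and \<open>\<epsilon> = 3/2\<close> are \<open>e1 (- 5/32)\<close> and \<open>e1 (- 21/32)\<close>; their ratio is \<open>-1\<close>.\<close>
    let ?c = "e1 (- (21/32))"
    have "e1 (- (5/32)) = e1 (1/2) * ?c" by (simp flip: e1_add)
    thus "?V = - ?c * theta (1/2) (3/2) (2 * \<tau>) 0"
      unfolding \<kappa>_def theta_tau_add_1 by (simp add: e1_half power2_eq_square)
    show "?U = ?c * theta (3/2) (3/2) (2 * \<tau>) 0"
      unfolding \<kappa>_def theta_tau_add_1 by (simp add: power2_eq_square)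
  qed simp
  ultimately have "c * ((\<i> - 1) * (theta3 (2 * \<tau>) * theta (3/2) (3/2) (2 * \<tau>) 0))
      = c * (of_real (sqrt 2) * ((1 + \<i>) / 2 * (theta4 \<tau> - \<i> * theta3 \<tau>)) * theta (1/2) (3/2) (2 * \<tau>) 0)"
    by (simp add: mult_ac)
  hence eq: "(\<i> - 1) * (theta3 (2 * \<tau>) * theta (3/2) (3/2) (2 * \<tau>) 0)
      = of_real (sqrt 2) * ((1 + \<i>) / 2 * (theta4 \<tau> - \<i> * theta3 \<tau>)) * theta (1/2) (3/2) (2 * \<tau>) 0"
    by (rule mult_left_cancel [OF c(1), THEN iffD1])
  have inverse: "- ((1 + \<i>) / 2) * (\<i> - 1) = 1" and square: "- ((1 + \<i>) / 2) * ((1 + \<i>) / 2) = - (\<i> / 2)"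
    by (simp_all add: complex_eq_iff)
  have "theta3 (2 * \<tau>) * theta (3/2) (3/2) (2 * \<tau>) 0
      = - ((1 + \<i>) / 2) * ((\<i> - 1) * (theta3 (2 * \<tau>) * theta (3/2) (3/2) (2 * \<tau>) 0))"
    unfolding mult.assoc [symmetric] inverse by simp
  also have "\<dots> = - ((1 + \<i>) / 2) * ((1 + \<i>) / 2) *
      (of_real (sqrt 2) * (theta4 \<tau> - \<i> * theta3 \<tau>) * theta (1/2) (3/2) (2 * \<tau>) 0)"
    unfolding eq by (simp only: mult_ac)
  also have "\<dots> = - (\<i> * of_real (sqrt 2) / 2) * (theta4 \<tau> - \<i> * theta3 \<tau>) * theta (1/2) (3/2) (2 * \<tau>) 0"
    unfolding square by simp
  finally show ?thesis .
qed

text \<open>The shift by 1 turns characteristic \<open>(1/2, 0)\<close> into \<open>(1/2, 3/2)\<close>.\<close>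

lemma log_deriv_half_3_2:
  assumes "Im \<tau> > 0"
  shows "theta_deriv (1/2) (3/2) \<tau> 0 = of_real pi * \<i> / 2 * ((theta4 \<tau>)\<^sup>2 - \<i> * (theta2 \<tau>)\<^sup>2) * theta (1/2) (3/2) \<tau> 0"
proof -
  have "(e1 (1/8))\<^sup>2 = \<i>"
    using e1_add [of "1/8" "1/8"] by (simp add: e1_quarter power2_eq_square)
  hence "theta_deriv (1/2) 0 (\<tau> + 1) 0
      = of_real pi * \<i> / 2 * ((theta4 \<tau>)\<^sup>2 - \<i> * (theta2 \<tau>)\<^sup>2) * theta (1/2) 0 (\<tau> + 1) 0"
    using log_deriv_half_0 [of "\<tau> + 1"] assms by (simp add: theta_tau_add_1_const power_mult_distrib)
  thus ?thesis
    by (rule log_deriv_tau_add_1 [OF assms]) simp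
qed

lemma log_deriv_half_1_4:
  assumes "Im \<tau> > 0"
  shows "theta_deriv (1/2) (1/4) \<tau> 0 = of_real pi * \<i> / 2 *
           ((theta3 (4*\<tau>))\<^sup>2 - (theta2 (4*\<tau>))\<^sup>2 - \<i> * (theta2 (2*\<tau>))\<^sup>2
            - of_real (sqrt 2) * theta2 (2*\<tau>) * (theta4 \<tau> - \<i> * theta3 \<tau>)) * theta (1/2) (1/4) \<tau> 0"
proof -
  have \<tau>2: "Im (2 * \<tau>) > 0" and s: "Im (2 * \<tau> + 1) > 0" using assms by simp_all
  have nz: "theta (1/2) (3/2) (2 * \<tau>) 0 \<noteq> 0"
    using theta_half_0_nonzero [OF s] unfolding theta_tau_add_1 by simp
  have sq: "(theta4 (2 * \<tau>))\<^sup>2 = (theta3 (4 * \<tau>))\<^sup>2 - (theta2 (4 * \<tau>))\<^sup>2"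
    using theta4_squared [OF \<tau>2] by simp
  let ?L = "of_real pi * \<i> / 2 * ((theta4 (2 * \<tau>))\<^sup>2 - \<i> * (theta2 (2 * \<tau>))\<^sup>2)"
  let ?M = "- (\<i> * of_real (sqrt 2) / 2) * theta2 (2 * \<tau>) * (theta4 \<tau> - \<i> * theta3 \<tau>)"
  have "theta2 (2 * \<tau>) * theta3 (2 * \<tau>) * theta (3/2) (3/2) (2 * \<tau>) 0
      = theta2 (2 * \<tau>) * (- (\<i> * of_real (sqrt 2) / 2) * (theta4 \<tau> - \<i> * theta3 \<tau>) * theta (1/2) (3/2) (2 * \<tau>) 0)"
    unfolding theta_half_3_2_ratio [OF assms, symmetric] by (simp only: mult.assoc)
  also have "\<dots> = ?M * theta (1/2) (3/2) (2 * \<tau>) 0"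
    by (simp only: mult_ac)
  finally have M: "theta2 (2 * \<tau>) * theta3 (2 * \<tau>) * theta (3/2) (3/2) (2 * \<tau>) 0 = ?M * theta (1/2) (3/2) (2 * \<tau>) 0" .
  have num: "2 * (1/4) + 1 = (3/2 :: real)" "1/2 + 1 = (3/2 :: real)" by simp_all
  have "theta_deriv (1/2) (1/4) \<tau> 0 = (?L + of_real pi * ?M) * theta (1/2) (1/4) \<tau> 0"
    by (rule log_deriv_descent; (simp only: num)?) (rule assms log_deriv_half_3_2 [OF \<tau>2] M nz)+
  also have "?L + of_real pi * ?M = of_real pi * \<i> / 2 *
           ((theta3 (4*\<tau>))\<^sup>2 - (theta2 (4*\<tau>))\<^sup>2 - \<i> * (theta2 (2*\<tau>))\<^sup>2
            - of_real (sqrt 2) * theta2 (2*\<tau>) * (theta4 \<tau> - \<i> * theta3 \<tau>))"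
    unfolding sq by (simp add: field_simps)
  finally show ?thesis .
qed

text \<open>Repeated application of \<open>\<tau> \<mapsto> \<tau> + 1\<close> moves \<open>\<delta>\<close> by \<open>3/2\<close> modulo 2, hence through
  \<open>1/4, 7/4, 5/4, 3/4\<close>, and permutes the constants on the right-hand side up to fourth roots
  of unity.\<close>

lemma log_deriv_half_7_4:
  assumes "Im \<tau> > 0"
  shows "theta_deriv (1/2) (7/4) \<tau> 0 = of_real pi * \<i> / 2 *
           ((theta3 (4*\<tau>))\<^sup>2 - (theta2 (4*\<tau>))\<^sup>2 + \<i> * (theta2 (2*\<tau>))\<^sup>2
            - of_real (sqrt 2) * theta2 (2*\<tau>) * (theta4 \<tau> + \<i> * theta3 \<tau>)) * theta (1/2) (7/4) \<tau> 0"
    (is "_ = ?X * _")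
proof -
  have arg: "2 * (\<tau> + 1) = 2 * \<tau> + 2" "4 * (\<tau> + 1) = 4 * \<tau> + 4" by simp_all
  have "theta_deriv (1/2) (1/4) (\<tau> + 1) 0 = ?X * theta (1/2) (1/4) (\<tau> + 1) 0"
    using log_deriv_half_1_4 [of "\<tau> + 1"] assms
    unfolding arg theta_tau_add_1_const theta_tau_add_2_const theta_tau_add_4_const
    by (simp add: algebra_simps)
  thus ?thesis
    by (rule log_deriv_tau_add_1 [OF assms]) simp
qed

lemma log_deriv_half_5_4:
  assumes "Im \<tau> > 0"
  shows "theta_deriv (1/2) (5/4) \<tau> 0 = of_real pi * \<i> / 2 *
           ((theta3 (4*\<tau>))\<^sup>2 - (theta2 (4*\<tau>))\<^sup>2 - \<i> * (theta2 (2*\<tau>))\<^sup>2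
            + of_real (sqrt 2) * theta2 (2*\<tau>) * (theta4 \<tau> - \<i> * theta3 \<tau>)) * theta (1/2) (5/4) \<tau> 0"
    (is "_ = ?X * _")
proof -
  have arg: "2 * (\<tau> + 1) = 2 * \<tau> + 2" "4 * (\<tau> + 1) = 4 * \<tau> + 4" by simp_all
  have "theta_deriv (1/2) (7/4) (\<tau> + 1) 0 = ?X * theta (1/2) (7/4) (\<tau> + 1) 0"
    using log_deriv_half_7_4 [of "\<tau> + 1"] assms
    unfolding arg theta_tau_add_1_const theta_tau_add_2_const theta_tau_add_4_const
    by (simp add: algebra_simps)
  hence "theta_deriv (1/2) (5/4 + 2) \<tau> 0 = ?X * theta (1/2) (5/4 + 2) \<tau> 0"
    by (rule log_deriv_tau_add_1 [OF assms]) simp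
  thus ?thesis
    by (rule log_deriv_delta_add_2 [OF assms])
qed

lemma log_deriv_half_3_4:
  assumes "Im \<tau> > 0"
  shows "theta_deriv (1/2) (3/4) \<tau> 0 = of_real pi * \<i> / 2 *
           ((theta3 (4*\<tau>))\<^sup>2 - (theta2 (4*\<tau>))\<^sup>2 + \<i> * (theta2 (2*\<tau>))\<^sup>2
            + of_real (sqrt 2) * theta2 (2*\<tau>) * (theta4 \<tau> + \<i> * theta3 \<tau>)) * theta (1/2) (3/4) \<tau> 0"
    (is "_ = ?X * _")
proof -
  have arg: "2 * (\<tau> + 1) = 2 * \<tau> + 2" "4 * (\<tau> + 1) = 4 * \<tau> + 4" by simp_all
  have "theta_deriv (1/2) (5/4) (\<tau> + 1) 0 = ?X * theta (1/2) (5/4) (\<tau> + 1) 0"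
    using log_deriv_half_5_4 [of "\<tau> + 1"] assms
    unfolding arg theta_tau_add_1_const theta_tau_add_2_const theta_tau_add_4_const
    by (simp add: algebra_simps)
  hence "theta_deriv (1/2) (3/4 + 2) \<tau> 0 = ?X * theta (1/2) (3/4 + 2) \<tau> 0"
    by (rule log_deriv_tau_add_1 [OF assms]) simp
  thus ?thesis
    by (rule log_deriv_delta_add_2 [OF assms])
qed

section \<open>The six derivative formulas\<close>

theorem theorem2p4:
  fixes \<tau> :: complex
  assumes "Im \<tau> > 0"
  shows
        "theta_deriv 0 (1/4) \<tau> 0 = - of_real pi * theta 0 (1/4) \<tau> 0 *
           (of_real (sqrt 2) * theta 0 0 (2*\<tau>) 0 * theta 1 0 (4*\<tau>) 0 - (theta 1 0 (4*\<tau>) 0)\<^sup>2) \<and>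
         theta_deriv 0 (3/4) \<tau> 0 = - of_real pi * theta 0 (3/4) \<tau> 0 *
           (of_real (sqrt 2) * theta 0 0 (2*\<tau>) 0 * theta 1 0 (4*\<tau>) 0 + (theta 1 0 (4*\<tau>) 0)\<^sup>2) \<and>
         theta_deriv (1/2) (1/4) \<tau> 0 = of_real pi * \<i> / 2 * theta (1/2) (1/4) \<tau> 0 *
           ((theta 0 0 (4*\<tau>) 0)\<^sup>2 - (theta 1 0 (4*\<tau>) 0)\<^sup>2 - \<i> * (theta 1 0 (2*\<tau>) 0)\<^sup>2
            - of_real (sqrt 2) * theta 1 0 (2*\<tau>) 0 * (theta 0 1 \<tau> 0 - \<i> * theta 0 0 \<tau> 0)) \<and>
         theta_deriv (1/2) (3/4) \<tau> 0 = of_real pi * \<i> / 2 * theta (1/2) (3/4) \<tau> 0 *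
           ((theta 0 0 (4*\<tau>) 0)\<^sup>2 - (theta 1 0 (4*\<tau>) 0)\<^sup>2 + \<i> * (theta 1 0 (2*\<tau>) 0)\<^sup>2
            + of_real (sqrt 2) * theta 1 0 (2*\<tau>) 0 * (theta 0 1 \<tau> 0 + \<i> * theta 0 0 \<tau> 0)) \<and>
         theta_deriv (1/2) (5/4) \<tau> 0 = of_real pi * \<i> / 2 * theta (1/2) (5/4) \<tau> 0 *
           ((theta 0 0 (4*\<tau>) 0)\<^sup>2 - (theta 1 0 (4*\<tau>) 0)\<^sup>2 - \<i> * (theta 1 0 (2*\<tau>) 0)\<^sup>2
            + of_real (sqrt 2) * theta 1 0 (2*\<tau>) 0 * (theta 0 1 \<tau> 0 - \<i> * theta 0 0 \<tau> 0)) \<and>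
         theta_deriv (1/2) (7/4) \<tau> 0 = of_real pi * \<i> / 2 * theta (1/2) (7/4) \<tau> 0 *
           ((theta 0 0 (4*\<tau>) 0)\<^sup>2 - (theta 1 0 (4*\<tau>) 0)\<^sup>2 + \<i> * (theta 1 0 (2*\<tau>) 0)\<^sup>2
            - of_real (sqrt 2) * theta 1 0 (2*\<tau>) 0 * (theta 0 1 \<tau> 0 + \<i> * theta 0 0 \<tau> 0))"
  using log_deriv_0_1_4 [OF assms] log_deriv_0_3_4 [OF assms] log_deriv_half_1_4 [OF assms]
    log_deriv_half_3_4 [OF assms] log_deriv_half_5_4 [OF assms] log_deriv_half_7_4 [OF assms]
  by (simp only: mult_ac simp_thms)

end
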